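(* For $2\le k_1$ and $2\le t\le\min\{k_2,d\}$, the dimension of $I_\emptyset$ is $$(t-1)(d+k_2)+k_2(k_1-1)-(t-1)^2=(t-1)(d+k_2-t+1)+k_2(k_1-1).$$
   Context: Let $k_1,k_2,d,t$ be integers as in the claim; $[n]=\{1,\dots,n\}$. Let $X=(x_{i(j,\ell)})$ be the $d\times k_1k_2$ matrix of indeterminates with rows $i\in[d]$ and columns $(j,\ell)\in[k_1]\times[k_2]$, and $\mathbb C[X]$ the polynomial ring over $\mathbb C$ in its entries. For $i\in[k_2]$ let $C_i=[k_1]\times\{i\}$ and let $X_{C_i}$ be the submatrix of $X$ with columns in $C_i$. For a submatrix $Y$ of $X$, $I_r(Y)\subseteq\mathbb C[X]$ is the ideal generated by all $r$-minors of $Y$. Define $I_\emptyset=I_t(X)+\sum_{i=1}^{k_2}I_2(X_{C_i})$. The dimension of an ideal $I\subseteq\mathbb C[X]$ is the Krull dimension of $\mathbb C[X]/I$, equivalently the dimension of the affine variety $V(I)\subseteq\mathbb C^{d\times k_1k_2}$. *)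

theory Defs
  imports
    "HOL-Algebra.QuotRing"
    "HOL-Library.Poly_Mapping"
    "HOL-Library.Extended_Nat"
    "Jordan_Normal_Form.Determinant"
begin

text \<open>
  The supremum is taken over the lengths of strict chains of prime ideals
  \<open>P 0 \<subset> \<dots> \<subset> P n\<close>. A ring without prime ideals, i.e. the zero ring, gets
  dimension \<open>0\<close> here instead of the customary \<open>-\<infinity>\<close>.
\<close>
definition krull_dim :: "('a, 'm) ring_scheme \<Rightarrow> enat" where
  "krull_dim R = Sup {enat n | n. \<exists>P :: nat \<Rightarrow> 'a set.
     (\<forall>i\<le>n. primeideal (P i) R) \<and> (\<forall>i<n. P i \<subset> P (Suc i))}"

text \<open>
  A monomial is a finitely supported exponent function \<open>'v \<Rightarrow>\<^sub>0 nat\<close>, and a polynomial maps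
  monomials to coefficients. The type \<open>'v\<close> may have more elements than there are
  indeterminates, so the ring of polynomials in the indeterminates indexed by \<open>V\<close> is cut
  out by its carrier.
\<close>
type_synonym ('v, 'a) mpoly = "('v \<Rightarrow>\<^sub>0 nat) \<Rightarrow>\<^sub>0 'a"

definition indet :: "'v \<Rightarrow> ('v, 'a::comm_ring_1) mpoly" where
  "indet v = Poly_Mapping.single (Poly_Mapping.single v 1) 1"

definition mpoly_ring :: "'v set \<Rightarrow> ('v, 'a::comm_ring_1) mpoly ring" where
  "mpoly_ring V =
     \<lparr>carrier = {p. \<forall>m\<in>Poly_Mapping.keys p. Poly_Mapping.keys m \<subseteq> V},
      monoid.mult = (*), one = 1, zero = 0, add = (+)\<rparr>"

lemma mpoly_ring_sel [simp]:
  "monoid.mult (mpoly_ring V) = (*)" "one (mpoly_ring V) = 1"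
  "zero (mpoly_ring V) = 0" "add (mpoly_ring V) = (+)"
  by (simp_all add: mpoly_ring_def)

lemma carrier_mpoly_ring:
  "p \<in> carrier (mpoly_ring V) \<longleftrightarrow> (\<forall>m\<in>Poly_Mapping.keys p. Poly_Mapping.keys m \<subseteq> V)"
  by (simp add: mpoly_ring_def)

lemma cring_mpoly_ring: "cring (mpoly_ring V :: ('v, 'a::comm_ring_1) mpoly ring)"
proof (rule cringI)
  let ?R = "mpoly_ring V :: ('v, 'a) mpoly ring"
  have mult: "p * q \<in> carrier ?R" if "p \<in> carrier ?R" "q \<in> carrier ?R" for p q
    unfolding carrier_mpoly_ring
  proof
    fix m assume "m \<in> Poly_Mapping.keys (p * q)"
    then obtain a b where m: "m = a + b" "a \<in> Poly_Mapping.keys p" "b \<in> Poly_Mapping.keys q"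
      using keys_mult[of p q] by blast
    then have "Poly_Mapping.keys a \<subseteq> V" "Poly_Mapping.keys b \<subseteq> V"
      using that by (simp_all add: carrier_mpoly_ring)
    then show "Poly_Mapping.keys m \<subseteq> V"
      using Poly_Mapping.keys_add[of a b] m(1) by blast
  qed
  have add: "p + q \<in> carrier ?R" if "p \<in> carrier ?R" "q \<in> carrier ?R" for p q
    using that Poly_Mapping.keys_add[of p q] unfolding carrier_mpoly_ring by blast
  have zero: "0 \<in> carrier ?R" and one: "1 \<in> carrier ?R"
    by (simp_all add: carrier_mpoly_ring)
  have minus: "- p \<in> carrier ?R" if "p \<in> carrier ?R" for p
    using that by (simp add: carrier_mpoly_ring)
  show "abelian_group ?R"
  proof (rule abelian_groupI, goal_cases)
    case (1 p q) then show ?case using add by simp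
  next
    case (6 p) then show ?case using minus[of p] by (intro bexI[of _ "- p"]) simp_all
  qed (simp_all add: zero add.assoc add.commute)
  show "comm_monoid ?R"
  proof (rule comm_monoidI, goal_cases)
    case (1 p q) then show ?case using mult by simp
  qed (simp_all add: one mult.assoc mult.commute)
qed (simp add: distrib_right)

text \<open>
  A matrix is a function of a row and a column index, and its submatrices are given by the sets
  \<open>R\<close> of rows and \<open>C\<close> of columns. The \<open>r\<close> rows and \<open>r\<close> columns of a minor may be listed in any
  order; this affects the minor only by a sign.
\<close>
definition minors :: "nat \<Rightarrow> ('r \<Rightarrow> 'c \<Rightarrow> 'a::comm_ring_1) \<Rightarrow> 'r set \<Rightarrow> 'c set \<Rightarrow> 'a set" where
  "minors r Y R C = {det (mat r r (\<lambda>(a, b). Y (f a) (g b))) | f g.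
     inj_on f {..<r} \<and> f ` {..<r} \<subseteq> R \<and> inj_on g {..<r} \<and> g ` {..<r} \<subseteq> C}"

text \<open>A column index is a pair \<open>(j, l)\<close>, so the indeterminates are indexed by \<open>(i, j, l)\<close>.\<close>
definition X_mat :: "nat \<Rightarrow> nat \<times> nat \<Rightarrow> (nat \<times> nat \<times> nat, complex) mpoly" where
  "X_mat i c = indet (i, c)"

definition CX :: "nat \<Rightarrow> nat \<Rightarrow> nat \<Rightarrow> (nat \<times> nat \<times> nat, complex) mpoly ring" where
  "CX d k1 k2 = mpoly_ring ({1..d} \<times> {1..k1} \<times> {1..k2})"

definition minor_ideal ::
  "nat \<Rightarrow> nat \<Rightarrow> nat \<Rightarrow> nat \<Rightarrow> (nat \<times> nat) set \<Rightarrow> (nat \<times> nat \<times> nat, complex) mpoly set" where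
  "minor_ideal d k1 k2 r C = genideal (CX d k1 k2) (minors r X_mat {1..d} C)"

definition C_cols :: "nat \<Rightarrow> nat \<Rightarrow> (nat \<times> nat) set" where
  "C_cols k1 i = {1..k1} \<times> {i}"

text \<open>The sum of a family of ideals is the ideal generated by their union.\<close>
definition I_empty :: "nat \<Rightarrow> nat \<Rightarrow> nat \<Rightarrow> nat \<Rightarrow> (nat \<times> nat \<times> nat, complex) mpoly set" where
  "I_empty d k1 k2 t = genideal (CX d k1 k2)
     (minor_ideal d k1 k2 t ({1..k1} \<times> {1..k2}) \<union>
      (\<Union>i\<in>{1..k2}. minor_ideal d k1 k2 2 (C_cols k1 i)))"

definition ideal_dim :: "('a, 'm) ring_scheme \<Rightarrow> 'a set \<Rightarrow> enat" where
  "ideal_dim R I = krull_dim (R Quot I)"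

end

theory Submission
  imports Defs
begin

text \<open>
  Put \<open>r = t - 1\<close> and \<open>D = (d - r) * r + r * k2 + k2 * (k1 - 1)\<close>, which is the asserted dimension.
  A zero of the ideal is a matrix of rank at most \<open>r\<close> whose blocks of columns have rank at most
  \<open>1\<close>. The block \<open>l\<close> is therefore a vector \<open>u\<^sub>l\<close> times a row of \<open>k1\<close> scalars, one of which may be taken
  to be \<open>1\<close>, and the \<open>d\<close> by \<open>k2\<close> matrix of the \<open>u\<^sub>l\<close> is given by \<open>r\<close> of its rows and by the
  coefficients that express the other \<open>d - r\<close> rows through them. This parametrizes the zeros by \<open>D\<close>
  numbers, and both inequalities follow from versions of this parametrization.

  Lower bound. Over the complex numbers take the first \<open>r\<close> rows as the basis and the
  first column of each block as \<open>u\<^sub>l\<close>. Setting the parameters to zero one after another gives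
  images of smaller and smaller linear spaces; the ideal of polynomials vanishing on such an image
  is prime (\<open>primeideal_stratum\<close>). The parameters can be ordered so that at each step some matrix
  entry becomes zero which was not identically zero before (\<open>stage_witness\<close>). This yields a
  chain of primes of length \<open>D\<close> above the ideal (\<open>exists_prime_chain\<close>).

  Upper bound. Let \<open>P 0 \<subset> \<dots> \<subset> P m\<close> be a chain of primes above the ideal. Elements
  \<open>f i \<in> P (i + 1) - P i\<close> are algebraically independent modulo \<open>P 0\<close>
  (\<open>chain_of_primes_independent\<close>), so it suffices that the quotient by \<open>P 0\<close> has transcendence
  degree at most \<open>D\<close>. Its generic point is a matrix over a domain subject to the same rank
  conditions. Cofactor expansion along a nonvanishing minor of maximal size and division by one
  nonzero entry per block write every entry as a polynomial of degree at most \<open>3\<close> in \<open>D\<close>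
  fractions with a common denominator (\<open>exists_parameters\<close>). A dimension count then finishes the
  argument: the number of power products of \<open>m\<close> elements with exponents at most \<open>N\<close> grows like \<open>N\<close> to the
  power \<open>m\<close>, whereas after clearing denominators they lie in spaces spanned by \<open>O(N\<^sup>D)\<close>
  homogeneous monomials (\<open>independent_family_le_parameters\<close>). Counting instead of field theory
  keeps all computations inside the polynomial ring.
\<close>

section \<open>Power products along a chain of prime ideals\<close>

text \<open>
  Gaussian elimination: an equation in which the unknown \<open>i0\<close> occurs is used to eliminate
  \<open>i0\<close> from the remaining equations.
\<close>
lemma homogeneous_system_has_nontrivial_solution:
  fixes a :: "'i \<Rightarrow> 'j \<Rightarrow> 'k::field"
  assumes "finite J" and "finite I" and "card J < card I"
  shows "\<exists>c. (\<exists>i\<in>I. c i \<noteq> 0) \<and> (\<forall>j\<in>J. (\<Sum>i\<in>I. c i * a i j) = 0)"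
  using assms
proof (induction J arbitrary: I a rule: finite_induct)
  case empty
  then obtain i where "i \<in> I"
    by (metis card.empty ex_in_conv less_irrefl)
  then show ?case
    by (intro exI[of _ "\<lambda>_. 1"]) auto
next
  case (insert j0 J)
  show ?case
  proof (cases "\<forall>i\<in>I. a i j0 = 0")
    case True
    have "card J < card I" using insert by simp
    from insert.IH[OF insert.prems(1) this, of a] True show ?thesis by auto
  next
    case False
    then obtain i0 where i0: "i0 \<in> I" "a i0 j0 \<noteq> 0" by blast
    define I' where "I' = I - {i0}"
    have I: "I = insert i0 I'" "i0 \<notin> I'" "finite I'"
      using i0 insert.prems by (auto simp: I'_def)
    define b where "b i j = a i j - a i j0 / a i0 j0 * a i0 j" for i j
    have "card J < card I'" using insert.prems insert.hyps I by simp
    from insert.IH[OF \<open>finite I'\<close> this, of b] obtain c where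
      c: "\<exists>i\<in>I'. c i \<noteq> 0" "\<forall>j\<in>J. (\<Sum>i\<in>I'. c i * b i j) = 0" by blast
    define c' where "c' = c(i0 := - (\<Sum>i\<in>I'. c i * a i j0) / a i0 j0)"
    have "(\<Sum>i\<in>I. c' i * a i j) = (\<Sum>i\<in>I'. c i * b i j)" for j
    proof -
      have "(\<Sum>i\<in>I. c' i * a i j) = c' i0 * a i0 j + (\<Sum>i\<in>I'. c' i * a i j)"
        using I by simp
      also have "(\<Sum>i\<in>I'. c' i * a i j) = (\<Sum>i\<in>I'. c i * a i j)"
        using I(2) by (intro sum.cong) (auto simp: c'_def)
      also have "c' i0 * a i0 j = - (\<Sum>i\<in>I'. c i * (a i j0 / a i0 j0 * a i0 j))"
        by (simp add: c'_def sum_distrib_right sum_divide_distrib sum_negf mult.assoc)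
      finally show ?thesis
        by (simp add: b_def right_diff_distrib sum_subtractf)
    qed
    moreover have "(\<Sum>i\<in>I'. c i * b i j0) = 0"
      using i0 by (simp add: b_def)
    ultimately have "\<forall>j\<in>insert j0 J. (\<Sum>i\<in>I. c' i * a i j) = 0"
      using c(2) by simp
    moreover have "\<exists>i\<in>I. c' i \<noteq> 0"
      using c(1) I by (auto simp: c'_def)
    ultimately show ?thesis by blast
  qed
qed

definition bounded_exponents :: "nat \<Rightarrow> nat \<Rightarrow> nat list set" where
  "bounded_exponents n N = {es. set es \<subseteq> {..N} \<and> length es = n}"

definition power_product :: "'a::comm_ring_1 list \<Rightarrow> nat list \<Rightarrow> 'a" where
  "power_product fs es = prod_list (map2 (^) fs es)"

lemma finite_bounded_exponents: "finite (bounded_exponents n N)"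
  and card_bounded_exponents: "card (bounded_exponents n N) = (N + 1) ^ n"
  using finite_lists_length_eq[of "{..N}" n] card_lists_length_eq[of "{..N}" n]
  by (simp_all add: bounded_exponents_def)

lemma bounded_exponents_0: "bounded_exponents 0 N = {[]}"
  by (auto simp: bounded_exponents_def)

lemma sum_bounded_exponents_Suc: "(\<Sum>es\<in>bounded_exponents (Suc n) N. h es) = (\<Sum>e\<le>N. \<Sum>es\<in>bounded_exponents n N. h (e # es))"
proof -
  have *: "bounded_exponents (Suc n) N = (\<lambda>(e, es). e # es) ` ({..N} \<times> bounded_exponents n N)"
    by (auto simp: bounded_exponents_def length_Suc_conv image_iff)
  have "(\<Sum>es\<in>bounded_exponents (Suc n) N. h es) = (\<Sum>(e, es)\<in>{..N} \<times> bounded_exponents n N. h (e # es))"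
    unfolding * by (subst sum.reindex) (auto simp: inj_on_def case_prod_beta)
  then show ?thesis by (simp add: sum.cartesian_product)
qed

text \<open>
  The subalgebra \<open>A\<close> is a subset of a ring type, so that calculations in it use the operations of
  the type; \<open>\<kappa>\<close> embeds the field of scalars.
\<close>
locale subalgebra =
  fixes A :: "'a::comm_ring_1 set" and \<kappa> :: "'k::field \<Rightarrow> 'a"
  assumes A_add: "x \<in> A \<Longrightarrow> y \<in> A \<Longrightarrow> x + y \<in> A"
    and A_mult: "x \<in> A \<Longrightarrow> y \<in> A \<Longrightarrow> x * y \<in> A"
    and \<kappa>_A: "\<kappa> c \<in> A"
    and \<kappa>_1: "\<kappa> 1 = 1"
    and \<kappa>_add: "\<kappa> (c + c') = \<kappa> c + \<kappa> c'"
    and \<kappa>_mult: "\<kappa> (c * c') = \<kappa> c * \<kappa> c'"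
begin

lemma \<kappa>_0: "\<kappa> 0 = 0"
  using \<kappa>_add[of 0 0] by simp

lemma \<kappa>_sum: "\<kappa> (sum h S) = (\<Sum>i\<in>S. \<kappa> (h i))"
  by (induction S rule: infinite_finite_induct) (auto simp: \<kappa>_0 \<kappa>_add)

lemma \<kappa>_minus: "\<kappa> (- c) = - \<kappa> c"
  using \<kappa>_add[of "c" "- c"] by (simp add: \<kappa>_0 add_eq_0_iff)

lemma A_one: "1 \<in> A" and A_zero: "0 \<in> A"
  using \<kappa>_A[of 1] \<kappa>_A[of 0] by (simp_all add: \<kappa>_1 \<kappa>_0)

lemma A_minus: "x \<in> A \<Longrightarrow> - x \<in> A"
  using A_mult[OF \<kappa>_A[of "- 1"], of x] by (simp add: \<kappa>_minus \<kappa>_1)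

lemma A_sum: "(\<And>i. i \<in> S \<Longrightarrow> h i \<in> A) \<Longrightarrow> sum h S \<in> A"
  by (induction S rule: infinite_finite_induct) (auto simp: A_zero A_add)

lemma A_prod: "(\<And>i. i \<in> S \<Longrightarrow> h i \<in> A) \<Longrightarrow> prod h S \<in> A"
  by (induction S rule: infinite_finite_induct) (auto simp: A_one A_mult)

lemma A_power: "x \<in> A \<Longrightarrow> x ^ n \<in> A"
  by (induction n) (auto simp: A_one A_mult)

lemma power_product_A: "set fs \<subseteq> A \<Longrightarrow> power_product fs es \<in> A"
proof (induction fs arbitrary: es)
  case (Cons f fs)
  then show ?case by (cases es) (auto simp: power_product_def A_mult A_power A_one)
qed (simp add: power_product_def A_one)

lemma det_A:
  assumes "\<And>a b. a < r \<Longrightarrow> b < r \<Longrightarrow> h a b \<in> A"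
  shows "det (mat r r (\<lambda>(a, b). h a b)) \<in> A"
proof -
  have "signof p \<in> A" for p :: "nat \<Rightarrow> nat"
    by (cases p rule: sign_cases) (auto simp: A_one A_minus)
  moreover have "p a < r" if "p permutes {0..<r}" "a < r" for p a
    using permutes_in_image[OF that(1), of a] that(2) by simp
  ultimately show ?thesis
    by (auto simp: det_def intro!: A_sum A_mult A_prod assms)
qed

end

locale prime_of_subalgebra = subalgebra A \<kappa>
  for A P :: "'a::comm_ring_1 set" and \<kappa> :: "'k::field \<Rightarrow> 'a" +
  assumes P_A: "P \<subseteq> A"
    and P_add: "x \<in> P \<Longrightarrow> y \<in> P \<Longrightarrow> x + y \<in> P"
    and P_mult: "x \<in> A \<Longrightarrow> y \<in> P \<Longrightarrow> x * y \<in> P"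
    and P_one: "1 \<notin> P"
    and P_zero: "0 \<in> P"
    and P_prime: "x \<in> A \<Longrightarrow> y \<in> A \<Longrightarrow> x * y \<in> P \<Longrightarrow> x \<in> P \<or> y \<in> P"
begin

lemma P_minus: "x \<in> P \<Longrightarrow> - x \<in> P"
  using P_mult[OF \<kappa>_A[of "- 1"], of x] by (simp add: \<kappa>_minus \<kappa>_1)

lemma P_diff: "x \<in> P \<Longrightarrow> y \<in> P \<Longrightarrow> x - y \<in> P"
  using P_add[of x "- y"] P_minus by simp

lemma P_mult_right: "x \<in> P \<Longrightarrow> y \<in> A \<Longrightarrow> x * y \<in> P"
  using P_mult[of y x] by (simp add: mult.commute)

lemma P_sum: "(\<And>i. i \<in> S \<Longrightarrow> h i \<in> P) \<Longrightarrow> sum h S \<in> P"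
  by (induction S rule: infinite_finite_induct) (auto simp: P_zero P_add)

lemma P_power: "x \<in> A \<Longrightarrow> x ^ n \<in> P \<Longrightarrow> x \<in> P"
  by (induction n) (use P_prime A_power P_one in auto)

lemma notin_P_prod:
  assumes "\<And>i. i \<in> S \<Longrightarrow> h i \<in> A - P"
  shows "prod h S \<notin> P"
  using assms
proof (induction S rule: infinite_finite_induct)
  case (insert i S)
  then show ?case using P_prime[of "h i" "prod h S"] A_prod[of S h] by auto
qed (auto simp: P_one)

lemma \<kappa>_in_P: "\<kappa> c \<in> P \<Longrightarrow> c = 0"
  using P_mult[OF \<kappa>_A[of "inverse c"], of "\<kappa> c"] P_one
  by (cases "c = 0") (auto simp: \<kappa>_mult[symmetric] \<kappa>_1)

text \<open>
  A polynomial in one element \<open>f \<in> Q - P\<close> that vanishes modulo \<open>P\<close> has its constant coefficient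
  in \<open>Q\<close>. If the coefficients are such that membership in \<open>Q\<close> forces them to be \<open>0\<close>, the
  constant coefficient disappears, and \<open>f\<close> can be cancelled because \<open>P\<close> is prime.
\<close>
lemma coefficients_vanish:
  assumes Q: "P \<subseteq> Q" "\<And>x y. x \<in> Q \<Longrightarrow> y \<in> Q \<Longrightarrow> x - y \<in> Q"
      "\<And>x y. x \<in> A \<Longrightarrow> y \<in> Q \<Longrightarrow> x * y \<in> Q"
    and f: "f \<in> A" "f \<in> Q" "f \<notin> P"
    and g: "\<And>e. e \<le> N \<Longrightarrow> g e \<in> A" "\<And>e. e \<le> N \<Longrightarrow> g e \<in> Q \<Longrightarrow> g e = 0"
    and sum: "(\<Sum>e\<le>N. f ^ e * g e) \<in> P"
  shows "\<forall>e\<le>N. g e = 0"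
  using g sum
proof (induction N arbitrary: g)
  case 0
  then show ?case using Q(1) by auto
next
  case (Suc N)
  let ?s = "\<Sum>e\<le>N. f ^ e * g (Suc e)"
  have s: "?s \<in> A" by (intro A_sum A_mult A_power f Suc.prems) auto
  have *: "(\<Sum>e\<le>Suc N. f ^ e * g e) = g 0 + f * ?s"
    by (simp add: sum.atMost_Suc_shift sum_distrib_left mult.assoc del: sum.atMost_Suc)
  have "?s * f \<in> Q" using Q(3)[OF s f(2)] .
  then have "(\<Sum>e\<le>Suc N. f ^ e * g e) - ?s * f \<in> Q"
    using Q(2) Q(1) Suc.prems(3) by blast
  then have "g 0 \<in> Q" unfolding * by (simp add: mult.commute)
  then have g0: "g 0 = 0" using Suc.prems(2)[of 0] by auto
  then have "f * ?s \<in> P" using Suc.prems(3) * by (simp del: sum.atMost_Suc)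
  then have "?s \<in> P" using P_prime f s by blast
  then have "\<forall>e\<le>N. g (Suc e) = 0"
    by (intro Suc.IH[of "\<lambda>e. g (Suc e)"]) (use Suc.prems in auto)
  then show ?case using g0 by (metis Suc_le_mono not0_implies_Suc)
qed

end

text \<open>
  This replaces the usual comparison of transcendence degrees along a chain of primes. Modulo
  \<open>Pc 0\<close>, a polynomial relation between the elements of \<open>fs\<close> is a polynomial in the first of them,
  which lies in \<open>Pc 1\<close> but not in \<open>Pc 0\<close>; its coefficients are polynomials in the others,
  and for these the shifted chain starting at \<open>Pc 1\<close> shows that they can lie in \<open>Pc 1\<close> only
  if they are zero.
\<close>
lemma chain_of_primes_independent:
  fixes Pc :: "nat \<Rightarrow> 'a::comm_ring_1 set"
  assumes "\<And>i. i \<le> length fs \<Longrightarrow> prime_of_subalgebra A (Pc i) \<kappa>"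
    and "\<And>i. i < length fs \<Longrightarrow> Pc i \<subseteq> Pc (Suc i)"
    and "\<And>i. i < length fs \<Longrightarrow> fs ! i \<in> Pc (Suc i) - Pc i"
    and "(\<Sum>es\<in>bounded_exponents (length fs) N. \<kappa> (c es) * power_product fs es) \<in> Pc 0"
  shows "\<forall>es\<in>bounded_exponents (length fs) N. c es = 0"
  using assms
proof (induction fs arbitrary: Pc c)
  case Nil
  interpret prime_of_subalgebra A "Pc 0" \<kappa> using Nil.prems(1) by simp
  show ?case using Nil.prems(4) \<kappa>_in_P by (simp add: bounded_exponents_0 power_product_def)
next
  case (Cons f fs)
  interpret P: prime_of_subalgebra A "Pc 0" \<kappa> using Cons.prems(1)[of 0] by simp
  interpret Q: prime_of_subalgebra A "Pc (Suc 0)" \<kappa> using Cons.prems(1)[of "Suc 0"] by simp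
  define g where "g e = (\<Sum>es\<in>bounded_exponents (length fs) N. \<kappa> (c (e # es)) * power_product fs es)" for e
  have f: "f \<in> Pc (Suc 0)" "f \<notin> Pc 0" "f \<in> A"
    using Cons.prems(3)[of 0] Q.P_A by auto
  have fs: "set fs \<subseteq> A"
  proof
    fix x assume "x \<in> set fs"
    then obtain i where i: "i < length fs" "x = fs ! i" by (auto simp: in_set_conv_nth)
    have "x \<in> Pc (Suc (Suc i))" using Cons.prems(3)[of "Suc i"] i by simp
    then show "x \<in> A"
      using prime_of_subalgebra.P_A[OF Cons.prems(1)[of "Suc (Suc i)"]] i by auto
  qed
  have gA: "g e \<in> A" for e
    unfolding g_def by (intro P.A_sum P.A_mult P.\<kappa>_A P.power_product_A fs)
  have IH: "\<forall>es\<in>bounded_exponents (length fs) N. c (e # es) = 0" if "g e \<in> Pc (Suc 0)" for e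
    by (rule Cons.IH[of "\<lambda>i. Pc (Suc i)" "\<lambda>es. c (e # es)"])
       (use Cons.prems(1) Cons.prems(2)[of "Suc _"] Cons.prems(3)[of "Suc _"] that
         in \<open>auto simp: g_def\<close>)
  have "(\<Sum>es\<in>bounded_exponents (length (f # fs)) N. \<kappa> (c es) * power_product (f # fs) es) = (\<Sum>e\<le>N. f ^ e * g e)"
    by (simp add: sum_bounded_exponents_Suc g_def sum_distrib_left power_product_def ac_simps)
  then have "\<forall>e\<le>N. g e = 0"
    using Cons.prems(4) Cons.prems(2)[of 0] IH f gA
    by (intro P.coefficients_vanish[of "Pc (Suc 0)" f])
       (auto simp: Q.P_diff Q.P_mult P.\<kappa>_0 g_def)
  then have "\<forall>e\<le>N. \<forall>es\<in>bounded_exponents (length fs) N. c (e # es) = 0"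
    using IH Q.P_zero by auto
  then show ?case
    by (auto simp: bounded_exponents_def length_Suc_conv)
qed

section \<open>Counting homogeneous forms in the numerators of fractions\<close>

text \<open>
  These are the monomials of degree \<open>M\<close> in the variables \<open>Y\<close> and the extra variable \<open>w\<close>,
  which fills up the degree. Dividing by \<open>w ^ M\<close> turns them into the monomials of degree
  at most \<open>M\<close> in the fractions \<open>y / w\<close>; this is why \<open>w\<close> does not count as a parameter.
\<close>
definition hom_monomials :: "'a::comm_ring_1 set \<Rightarrow> 'a \<Rightarrow> nat \<Rightarrow> 'a set" where
  "hom_monomials Y w M = {(\<Prod>y\<in>Y. y ^ e y) * w ^ (M - sum e Y) | e. sum e Y \<le> M}"

lemma hom_monomials_mult:
  assumes "g \<in> hom_monomials Y w M" and "h \<in> hom_monomials Y w N"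
  shows "g * h \<in> hom_monomials Y w (M + N)"
proof -
  from assms obtain d e where
    "g = (\<Prod>y\<in>Y. y ^ d y) * w ^ (M - sum d Y)" "sum d Y \<le> M"
    "h = (\<Prod>y\<in>Y. y ^ e y) * w ^ (N - sum e Y)" "sum e Y \<le> N"
    by (auto simp: hom_monomials_def)
  moreover from this have
    "w ^ (M - sum d Y) * w ^ (N - sum e Y) = w ^ (M + N - (sum d Y + sum e Y))"
    by (simp flip: power_add)
  ultimately have "g * h = (\<Prod>y\<in>Y. y ^ (d y + e y)) * w ^ (M + N - (\<Sum>y\<in>Y. d y + e y))"
    "(\<Sum>y\<in>Y. d y + e y) \<le> M + N"
    by (simp_all add: power_add prod.distrib sum.distrib mult_ac add_mono)
  then show ?thesis by (auto simp: hom_monomials_def)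
qed

lemma hom_monomials_subset_image:
  "hom_monomials Y w M \<subseteq> (\<lambda>e. (\<Prod>y\<in>Y. y ^ e y) * w ^ (M - sum e Y)) ` (Y \<rightarrow>\<^sub>E {..M})"
  if "finite Y"
proof
  fix x assume "x \<in> hom_monomials Y w M"
  then obtain e where e: "x = (\<Prod>y\<in>Y. y ^ e y) * w ^ (M - sum e Y)" "sum e Y \<le> M"
    by (auto simp: hom_monomials_def)
  have "e y \<le> M" if "y \<in> Y" for y
    using member_le_sum[of y Y e] that \<open>finite Y\<close> e(2) by simp
  then show "x \<in> (\<lambda>e. (\<Prod>y\<in>Y. y ^ e y) * w ^ (M - sum e Y)) ` (Y \<rightarrow>\<^sub>E {..M})"
    by (intro image_eqI[of _ _ "restrict e Y"]) (auto simp: e(1))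
qed

lemma finite_hom_monomials: "finite Y \<Longrightarrow> finite (hom_monomials Y w M)"
  by (rule finite_subset[OF hom_monomials_subset_image]) (auto intro!: finite_PiE)

lemma card_hom_monomials: "finite Y \<Longrightarrow> card (hom_monomials Y w M) \<le> (M + 1) ^ card Y"
proof -
  assume Y: "finite Y"
  have "card (hom_monomials Y w M) \<le> card (Y \<rightarrow>\<^sub>E {..M})"
    by (rule order_trans[OF card_mono[OF _ hom_monomials_subset_image[OF Y]] card_image_le])
       (use Y in \<open>auto intro!: finite_PiE\<close>)
  also have "\<dots> = (M + 1) ^ card Y"
    using Y by (simp add: card_PiE)
  finally show ?thesis .
qed

lemma one_in_hom_monomials: "1 \<in> hom_monomials Y w 0"
  unfolding hom_monomials_def by (intro CollectI exI[of _ "\<lambda>_. 0"]) simp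

lemma denominator_in_hom_monomials: "w \<in> hom_monomials Y w 1"
  unfolding hom_monomials_def by (intro CollectI exI[of _ "\<lambda>_. 0"]) simp

lemma parameter_in_hom_monomials:
  assumes "finite Y" and "y \<in> Y"
  shows "y \<in> hom_monomials Y w 1"
proof -
  let ?e = "\<lambda>z. if z = y then 1 else 0::nat"
  have "(\<Prod>z\<in>Y. z ^ ?e z) = y" "sum ?e Y = 1"
    using assms by (simp_all add: if_distrib[of "\<lambda>n. _ ^ n"] prod.delta cong: if_cong)
  then show ?thesis
    unfolding hom_monomials_def by (intro CollectI exI[of _ ?e]) simp
qed

lemma (in subalgebra) hom_monomials_A:
  assumes "Y \<subseteq> A" "w \<in> A"
  shows "hom_monomials Y w M \<subseteq> A"
  using assms by (auto simp: hom_monomials_def intro!: A_mult A_prod A_power)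

context prime_of_subalgebra
begin

text \<open>
  The forms of degree \<open>M\<close> in \<open>Y\<close> and \<open>w\<close>, modulo \<open>P\<close>. For \<open>w \<notin> P\<close> the statement
  \<open>w ^ M * x \<in> forms Y w M\<close> says that in the field of fractions of \<open>A / P\<close> the element \<open>x\<close> is a
  polynomial of degree at most \<open>M\<close> in the fractions \<open>y / w\<close>.
\<close>
inductive_set forms :: "'a set \<Rightarrow> 'a \<Rightarrow> nat \<Rightarrow> 'a set" for Y w M where
  forms_P: "p \<in> P \<Longrightarrow> p \<in> forms Y w M"
| forms_monomial: "g \<in> hom_monomials Y w M \<Longrightarrow> \<kappa> c * g \<in> forms Y w M"
| forms_add: "x \<in> forms Y w M \<Longrightarrow> y \<in> forms Y w M \<Longrightarrow> x + y \<in> forms Y w M"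

lemma monomial_in_forms: "g \<in> hom_monomials Y w M \<Longrightarrow> g \<in> forms Y w M"
  using forms_monomial[of g Y w M 1] by (simp add: \<kappa>_1)

lemma forms_sum: "(\<And>i. i \<in> S \<Longrightarrow> h i \<in> forms Y w M) \<Longrightarrow> sum h S \<in> forms Y w M"
  by (induction S rule: infinite_finite_induct) (auto intro: forms_add forms_P P_zero)

lemma forms_A:
  assumes "x \<in> forms Y w M" "Y \<subseteq> A" "w \<in> A"
  shows "x \<in> A"
  using assms(1)
proof induction
  case (forms_monomial g c)
  then show ?case
    using hom_monomials_A[OF assms(2,3)] A_mult \<kappa>_A by blast
qed (use P_A A_add in auto)

lemma forms_mult:
  assumes x: "x \<in> forms Y w M" and y: "y \<in> forms Y w N" and Y: "Y \<subseteq> A" "w \<in> A"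
  shows "x * y \<in> forms Y w (M + N)"
  using x
proof induction
  case (forms_P p)
  then show ?case using forms_A[OF y Y] P_mult_right by (auto intro: forms.forms_P)
next
  case (forms_monomial g c)
  note g = forms_monomial
  have gA: "\<kappa> c * g \<in> A"
    using g hom_monomials_A[OF Y] A_mult \<kappa>_A by blast
  from y show ?case
  proof induction
    case (forms_P p)
    then show ?case using gA P_mult by (auto intro: forms.forms_P)
  next
    case (forms_monomial h c')
    have "\<kappa> c * g * (\<kappa> c' * h) = \<kappa> (c * c') * (g * h)"
      by (simp add: \<kappa>_mult ac_simps)
    then show ?case
      using hom_monomials_mult[OF g forms_monomial] by (metis forms.forms_monomial)
  next
    case (forms_add x y)
    then show ?case by (simp add: distrib_left forms.forms_add)
  qed
next
  case (forms_add x y)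
  then show ?case by (simp add: distrib_right forms.forms_add)
qed

lemma forms_expansion:
  assumes "x \<in> forms Y w M" and "finite Y"
  shows "\<exists>a. x - (\<Sum>g\<in>hom_monomials Y w M. \<kappa> (a g) * g) \<in> P"
  using assms(1)
proof induction
  case (forms_P p)
  then show ?case by (intro exI[of _ "\<lambda>_. 0"]) (simp add: \<kappa>_0)
next
  case (forms_monomial g c)
  have "(\<Sum>h\<in>hom_monomials Y w M. \<kappa> (if h = g then c else 0) * h)
      = (\<Sum>h\<in>hom_monomials Y w M. if h = g then \<kappa> c * g else 0)"
    by (intro sum.cong) (auto simp: \<kappa>_0)
  also have "\<dots> = \<kappa> c * g"
    using forms_monomial finite_hom_monomials[OF \<open>finite Y\<close>] by simp
  finally show ?case
    by (intro exI[of _ "\<lambda>h. if h = g then c else 0"]) (simp add: P_zero)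
next
  case (forms_add x y)
  then obtain a b where
    "x - (\<Sum>g\<in>hom_monomials Y w M. \<kappa> (a g) * g) \<in> P"
    "y - (\<Sum>g\<in>hom_monomials Y w M. \<kappa> (b g) * g) \<in> P" by blast
  from P_add[OF this] show ?case
    by (intro exI[of _ "\<lambda>g. a g + b g"])
       (simp add: \<kappa>_add distrib_right sum.distrib algebra_simps)
qed

lemma fraction_raise:
  assumes "w ^ M * x \<in> forms Y w M" and "Y \<subseteq> A" "w \<in> A" and "M \<le> N"
  shows "w ^ N * x \<in> forms Y w N"
proof -
  have "w ^ k * (w ^ M * x) \<in> forms Y w (k + M)" for k
  proof (induction k)
    case (Suc k)
    from forms_mult[OF monomial_in_forms[OF denominator_in_hom_monomials] this assms(2,3)]
    show ?case by (simp add: mult.assoc)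
  qed (use assms in simp)
  from this[of "N - M"] show ?thesis
    using \<open>M \<le> N\<close> by (simp flip: power_add mult.assoc)
qed

lemma fraction_mult:
  assumes "w ^ M * x \<in> forms Y w M" and "w ^ N * y \<in> forms Y w N" and "Y \<subseteq> A" "w \<in> A"
  shows "w ^ (M + N) * (x * y) \<in> forms Y w (M + N)"
  using forms_mult[OF assms] by (simp add: power_add ac_simps)

lemma fraction_power:
  assumes "w ^ M * x \<in> forms Y w M" and "Y \<subseteq> A" "w \<in> A"
  shows "w ^ (M * e) * x ^ e \<in> forms Y w (M * e)"
proof (induction e)
  case 0
  show ?case using monomial_in_forms[OF one_in_hom_monomials] by simp
next
  case (Suc e)
  from fraction_mult[OF assms(1) this assms(2,3)] show ?case by simp
qed

lemma fraction_power_product: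
  assumes "\<And>f. f \<in> set fs \<Longrightarrow> w ^ M * f \<in> forms Y w M" and Y: "Y \<subseteq> A" "w \<in> A"
    and "es \<in> bounded_exponents (length fs) N"
  shows "w ^ (M * N * length fs) * power_product fs es \<in> forms Y w (M * N * length fs)"
  using assms(1,4)
proof (induction fs arbitrary: es)
  case Nil
  then show ?case using monomial_in_forms[OF one_in_hom_monomials] by (simp add: bounded_exponents_0 power_product_def)
next
  case (Cons f fs)
  then obtain e es' where es: "es = e # es'" "e \<le> N" "es' \<in> bounded_exponents (length fs) N"
    by (auto simp: bounded_exponents_def length_Suc_conv)
  have "w ^ (M * e) * f ^ e \<in> forms Y w (M * e)"
    by (rule fraction_power[OF Cons.prems(1) Y]) simp
  then have "w ^ (M * N) * f ^ e \<in> forms Y w (M * N)"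
    by (rule fraction_raise[OF _ Y]) (use es in simp)
  from fraction_mult[OF this Cons.IH[OF Cons.prems(1) es(3)] Y]
  show ?case by (simp add: es power_product_def add.commute mult.commute)
qed

text \<open>
  For some \<open>m\<close> every member of \<open>fs\<close> is modulo \<open>P\<close> a polynomial of degree at most \<open>m\<close> in the
  fractions \<open>y / w\<close>. With \<open>n = length fs\<close>, multiplication by \<open>w ^ L\<close>, where
  \<open>L = m * N * n\<close>, takes the \<open>(N + 1) ^ n\<close> power products with exponents at most \<open>N\<close> into a
  space with at most \<open>(L + 1) ^ card Y\<close> generators. If \<open>n\<close> exceeded \<open>card Y\<close>, this number
  would be too small for large \<open>N\<close>, and a linear relation between the power products would result.
\<close>
theorem independent_family_le_parameters:
  assumes Y: "finite Y" "Y \<subseteq> A" and w: "w \<in> A" "w \<notin> P" and fs: "set fs \<subseteq> A"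
    and indep: "\<And>N c. (\<Sum>es\<in>bounded_exponents (length fs) N. \<kappa> (c es) * power_product fs es) \<in> P
                  \<Longrightarrow> \<forall>es\<in>bounded_exponents (length fs) N. c es = 0"
    and fractions: "\<And>f. f \<in> set fs \<Longrightarrow> \<exists>M. w ^ M * f \<in> forms Y w M"
  shows "length fs \<le> card Y"
proof (rule ccontr)
  assume less: "\<not> length fs \<le> card Y"
  define n D where "n = length fs" and "D = card Y"
  from fractions obtain M where M: "\<And>f. f \<in> set fs \<Longrightarrow> w ^ M f * f \<in> forms Y w (M f)"
    by metis
  define m where "m = sum M (set fs)"
  have m: "w ^ m * f \<in> forms Y w m" if "f \<in> set fs" for f
    by (rule fraction_raise[OF M[OF that] Y(2) w(1)])
       (use that in \<open>auto simp: m_def intro: member_le_sum\<close>)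
  \<comment> \<open>\<open>L + 1 \<le> (m * n + 1) * (N + 1)\<close>, so this \<open>N\<close> bounds the constant
    factor \<open>(m * n + 1) ^ D\<close> by which the count of generators can exceed \<open>(N + 1) ^ D\<close>.\<close>
  define N where "N = (m * n + 1) ^ D"
  define L where "L = m * N * n"
  let ?G = "hom_monomials Y w L" and ?E = "bounded_exponents n N"
  have "\<forall>es\<in>?E. \<exists>a. w ^ L * power_product fs es - (\<Sum>g\<in>?G. \<kappa> (a g) * g) \<in> P"
    using fraction_power_product[OF m Y(2) w(1), where N = N] forms_expansion Y(1)
    unfolding L_def n_def by blast
  then obtain a where a: "\<And>es. es \<in> ?E \<Longrightarrow> w ^ L * power_product fs es - (\<Sum>g\<in>?G. \<kappa> (a es g) * g) \<in> P"
    by metis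
  have "card ?G < card ?E"
  proof -
    have "card ?G \<le> (L + 1) ^ D" using card_hom_monomials[OF Y(1)] D_def by blast
    also have "\<dots> \<le> ((m * n + 1) * (N + 1)) ^ D"
      by (intro power_mono) (auto simp: L_def algebra_simps)
    also have "\<dots> = N * (N + 1) ^ D" by (simp only: power_mult_distrib N_def)
    also have "\<dots> < (N + 1) ^ Suc D" by simp
    also have "\<dots> \<le> (N + 1) ^ n"
      using less by (intro power_increasing) (auto simp: n_def D_def)
    finally show ?thesis by (simp add: card_bounded_exponents)
  qed
  then obtain c where c: "\<exists>es\<in>?E. c es \<noteq> 0"
      "\<And>g. g \<in> ?G \<Longrightarrow> (\<Sum>es\<in>?E. c es * a es g) = 0"
    using homogeneous_system_has_nontrivial_solution[of ?G ?E a]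
      finite_hom_monomials[OF Y(1)] finite_bounded_exponents by metis
  define s where "s = (\<Sum>es\<in>?E. \<kappa> (c es) * power_product fs es)"
  have "(\<Sum>es\<in>?E. \<kappa> (c es) * (w ^ L * power_product fs es - (\<Sum>g\<in>?G. \<kappa> (a es g) * g))) \<in> P"
    by (intro P_sum P_mult \<kappa>_A a)
  moreover have "(\<Sum>es\<in>?E. \<kappa> (c es) * (\<Sum>g\<in>?G. \<kappa> (a es g) * g))
      = (\<Sum>g\<in>?G. \<kappa> (\<Sum>es\<in>?E. c es * a es g) * g)"
    by (simp add: \<kappa>_sum \<kappa>_mult sum_distrib_left sum_distrib_right mult.assoc)
       (rule sum.swap)
  moreover have "\<dots> = 0" using c(2) by (simp add: \<kappa>_0)
  ultimately have "(\<Sum>es\<in>?E. \<kappa> (c es) * (w ^ L * power_product fs es)) \<in> P"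
    by (simp add: right_diff_distrib sum_subtractf)
  then have "w ^ L * s \<in> P" by (simp add: s_def sum_distrib_left ac_simps)
  moreover have "s \<in> A" unfolding s_def by (intro A_sum A_mult \<kappa>_A power_product_A fs)
  ultimately have "s \<in> P" using P_prime[OF A_power[OF w(1)]] P_power[OF w(1)] w(2) by blast
  then show False using indep[of c N] c(1) by (auto simp: s_def n_def)
qed

end

section \<open>Krull dimension of a quotient ring\<close>

lemma coset_mem_image_iff:
  fixes R (structure)
  assumes "ring R" "ideal I R" "ideal J R" "I \<subseteq> J" "x \<in> carrier R"
  shows "I +> x \<in> (+>) I ` J \<longleftrightarrow> x \<in> J"
proof
  interpret R: ring R by fact
  interpret I: ideal I R by fact
  interpret J: ideal J R by fact
  assume "I +> x \<in> (+>) I ` J"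
  then obtain p where p: "p \<in> J" "I +> x = I +> p" by auto
  have "x \<in> I +> x" using I.a_rcos_self assms(5) by blast
  then have "x \<in> I +> p" using p by simp
  then obtain h where "h \<in> I" "x = h \<oplus> p" by (auto simp: a_r_coset_def')
  then show "x \<in> J" using p assms(4) by auto
qed auto

lemma carrier_Quot: "carrier (R Quot I) = (\<lambda>x. I +>\<^bsub>R\<^esub> x) ` carrier R"
  by (auto simp: FactRing_def A_RCOSETS_def')

lemma image_primeideal_Quot:
  fixes R (structure)
  assumes "cring R" "ideal I R" "primeideal P R" "I \<subseteq> P"
  shows "primeideal ((+>) I ` P) (R Quot I)"
proof -
  interpret R: cring R by fact
  interpret I: ideal I R by fact
  interpret P: primeideal P R by fact
  note mem = coset_mem_image_iff[OF R.ring_axioms assms(2) P.ideal_axioms assms(4)]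
  show ?thesis
  proof (rule primeidealI)
    show "ideal ((+>) I ` P) (R Quot I)"
      by (rule R.ring_ideal_imp_quot_ideal[OF assms(2) P.ideal_axioms])
    show "cring (R Quot I)" by (rule I.quotient_is_cring[OF assms(1)])
    show "carrier (R Quot I) \<noteq> (+>) I ` P"
    proof
      assume eq: "carrier (R Quot I) = (+>) I ` P"
      have "x \<in> P" if "x \<in> carrier R" for x
        using mem[OF that] that unfolding eq[symmetric] carrier_Quot by blast
      then show False using P.I_notcarr P.Icarr by blast
    qed
    fix a b assume "a \<in> carrier (R Quot I)" "b \<in> carrier (R Quot I)"
      and ab: "a \<otimes>\<^bsub>R Quot I\<^esub> b \<in> (+>) I ` P"
    then obtain x y where xy: "a = I +> x" "x \<in> carrier R" "b = I +> y" "y \<in> carrier R"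
      by (auto simp: carrier_Quot)
    then have "a \<otimes>\<^bsub>R Quot I\<^esub> b = I +> (x \<otimes> y)"
      by (simp add: FactRing_def I.rcoset_mult_add)
    then have "x \<otimes> y \<in> P" using ab mem xy by simp
    then show "a \<in> (+>) I ` P \<or> b \<in> (+>) I ` P"
      using P.I_prime xy by blast
  qed
qed

text \<open>
  Prime ideals of the quotient correspond to the prime ideals above \<open>I\<close>, strict inclusions
  included. Chains can therefore be built and bounded in \<open>R\<close> itself.
\<close>
lemma krull_dim_Quot_eqI:
  fixes R (structure)
  assumes R: "cring R" and I: "ideal I R"
    and chain: "\<And>i. i \<le> n \<Longrightarrow> primeideal (P i) R" "\<And>i. i \<le> n \<Longrightarrow> I \<subseteq> P i"
      "\<And>i. i < n \<Longrightarrow> P i \<subset> P (Suc i)"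
    and bound: "\<And>m Q. \<lbrakk>\<And>i. i \<le> m \<Longrightarrow> primeideal (Q i) R; \<And>i. i \<le> m \<Longrightarrow> I \<subseteq> Q i;
                  \<And>i. i < m \<Longrightarrow> Q i \<subset> Q (Suc i)\<rbrakk> \<Longrightarrow> m \<le> n"
  shows "krull_dim (R Quot I) = enat n"
proof -
  interpret R: cring R by fact
  interpret I: ideal I R by fact
  let ?S = "{enat m | m. \<exists>Q :: nat \<Rightarrow> 'a set set.
     (\<forall>i\<le>m. primeideal (Q i) (R Quot I)) \<and> (\<forall>i<m. Q i \<subset> Q (Suc i))}"
  have "enat n \<in> ?S"
  proof -
    have "(+>) I ` P i \<subset> (+>) I ` P (Suc i)" if i: "i < n" for i
    proof -
      obtain x where x: "x \<in> P (Suc i)" "x \<notin> P i" using chain(3)[OF i] by auto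
      interpret Pi: primeideal "P i" R using chain(1)[of i] i by simp
      interpret Ps: primeideal "P (Suc i)" R using chain(1)[of "Suc i"] i by simp
      have "I +> x \<notin> (+>) I ` P i"
        using coset_mem_image_iff[OF R.ring_axioms I Pi.ideal_axioms chain(2)] x i Ps.Icarr by simp
      then show ?thesis using x chain(3)[OF i] by blast
    qed
    then have "\<exists>Q :: nat \<Rightarrow> 'a set set.
        (\<forall>i\<le>n. primeideal (Q i) (R Quot I)) \<and> (\<forall>i<n. Q i \<subset> Q (Suc i))"
      by (intro exI[of _ "\<lambda>i. (+>) I ` P i"]) (auto intro: image_primeideal_Quot[OF R I chain(1) chain(2)])
    then show ?thesis by blast
  qed
  moreover have "s \<le> enat n" if "s \<in> ?S" for s
  proof -
    from that obtain m and Q :: "nat \<Rightarrow> 'a set set" where s: "s = enat m"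
      and Q: "\<And>i. i \<le> m \<Longrightarrow> primeideal (Q i) (R Quot I)" "\<And>i. i < m \<Longrightarrow> Q i \<subset> Q (Suc i)"
      by blast
    define T where "T i = {x \<in> carrier R. I +> x \<in> Q i}" for i
    have "m \<le> n"
    proof (rule bound[of m T])
      fix i assume i: "i \<le> m"
      show "primeideal (T i) R"
        unfolding T_def
        by (rule ring_hom_ring.primeideal_vimage[OF I.rcos_ring_hom_ring R Q(1)[OF i]])
      interpret Qi: primeideal "Q i" "R Quot I" using Q(1)[OF i] .
      have "I \<in> Q i" using additive_subgroup.zero_closed[OF ideal.axioms(1)[OF Qi.ideal_axioms]]
        by (simp add: FactRing_def)
      then show "I \<subseteq> T i"
        using R.a_coset_join2[OF I.Icarr I.a_subgroup] by (auto simp: T_def)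
    next
      fix i assume i: "i < m"
      interpret Qs: primeideal "Q (Suc i)" "R Quot I" using Q(1)[of "Suc i"] i by simp
      from Q(2)[OF i] obtain X where "X \<in> Q (Suc i)" "X \<notin> Q i" by blast
      then show "T i \<subset> T (Suc i)"
        using Q(2)[OF i] Qs.Icarr by (fastforce simp: T_def carrier_Quot)
    qed
    then show ?thesis using s by simp
  qed
  ultimately show ?thesis
    unfolding krull_dim_def by (intro antisym Sup_least Sup_upper) auto
qed

section \<open>Evaluation of polynomials and vanishing ideals\<close>

lemma poly_mapping_eq_sum_single:
  "p = (\<Sum>m\<in>Poly_Mapping.keys p. Poly_Mapping.single m (Poly_Mapping.lookup p m))"
  by (rule poly_mapping_eqI)
     (simp add: lookup_sum lookup_single when_def in_keys_iff)

lemma indet_power: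
  "(indet v :: ('v, 'a::comm_ring_1) mpoly) ^ k = Poly_Mapping.single (Poly_Mapping.single v k) 1"
proof (induction k)
  case (Suc k)
  then show ?case by (simp add: indet_def mult_single flip: single_add)
qed (simp flip: single_one)

lemma prod_single_monomial:
  "(\<Prod>v\<in>S. Poly_Mapping.single (f v) (1::'a::comm_ring_1)) = Poly_Mapping.single (sum f S) 1"
  by (induction S rule: infinite_finite_induct) (simp_all add: mult_single)

lemma single_eq_prod_indet:
  "Poly_Mapping.single m c
    = Poly_Mapping.single 0 c * (\<Prod>v\<in>Poly_Mapping.keys m. indet v ^ Poly_Mapping.lookup m v)"
  by (simp add: indet_power prod_single_monomial mult_single flip: poly_mapping_eq_sum_single)

lemma indet_in_carrier: "v \<in> V \<Longrightarrow> indet v \<in> carrier (mpoly_ring V)"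
  by (simp add: carrier_mpoly_ring indet_def)

lemma const_in_carrier: "Poly_Mapping.single 0 c \<in> carrier (mpoly_ring V)"
  by (simp add: carrier_mpoly_ring)

lemma mpoly_ring_induct [consumes 1, case_names const indet add mult]:
  fixes p :: "('v, 'a::comm_ring_1) mpoly"
  assumes "p \<in> carrier (mpoly_ring V)"
    and const: "\<And>c. Q (Poly_Mapping.single 0 c)" and indet: "\<And>v. v \<in> V \<Longrightarrow> Q (indet v)"
    and add: "\<And>p q. Q p \<Longrightarrow> Q q \<Longrightarrow> Q (p + q)" and mult: "\<And>p q. Q p \<Longrightarrow> Q q \<Longrightarrow> Q (p * q)"
  shows "Q p"
proof -
  have zero: "Q 0" using const[of 0] by simp
  have one: "Q 1" using const[of 1] by simp
  have sum: "Q (sum h S)" if "\<And>i. i \<in> S \<Longrightarrow> Q (h i)" for h :: "('v \<Rightarrow>\<^sub>0 nat) \<Rightarrow> _" and S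
    using that by (induction S rule: infinite_finite_induct) (auto intro: zero add)
  have prod: "Q (prod h S)" if "\<And>i. i \<in> S \<Longrightarrow> Q (h i)" for h :: "'v \<Rightarrow> _" and S
    using that by (induction S rule: infinite_finite_induct) (auto intro: one mult)
  have power: "Q (q ^ k)" if "Q q" for q k
    using that by (induction k) (auto intro: one mult)
  have "Q (Poly_Mapping.single m c)" if "m \<in> Poly_Mapping.keys p" for m c
    unfolding single_eq_prod_indet[of m c]
    by (intro mult const prod power indet)
       (use assms(1) that in \<open>auto simp: carrier_mpoly_ring\<close>)
  then show ?thesis
    by (subst poly_mapping_eq_sum_single[of p]) (rule sum)
qed

definition eval_mpoly :: "('v \<Rightarrow> 'a) \<Rightarrow> ('v, 'a::comm_ring_1) mpoly \<Rightarrow> 'a" where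
  "eval_mpoly a p = (\<Sum>m\<in>Poly_Mapping.keys p. Poly_Mapping.lookup p m *
      (\<Prod>v\<in>Poly_Mapping.keys m. a v ^ Poly_Mapping.lookup m v))"

lemma eval_mpoly_superset:
  assumes "finite S" "Poly_Mapping.keys p \<subseteq> S"
  shows "eval_mpoly a p = (\<Sum>m\<in>S. Poly_Mapping.lookup p m *
      (\<Prod>v\<in>Poly_Mapping.keys m. a v ^ Poly_Mapping.lookup m v))"
  unfolding eval_mpoly_def
  by (rule sum.mono_neutral_left) (use assms in \<open>auto simp: in_keys_iff\<close>)

lemma eval_mpoly_add: "eval_mpoly a (p + q) = eval_mpoly a p + eval_mpoly a q"
proof -
  let ?S = "Poly_Mapping.keys p \<union> Poly_Mapping.keys q"
  show ?thesis
    using Poly_Mapping.keys_add[of p q]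
    by (simp add: eval_mpoly_superset[of ?S] lookup_add distrib_right sum.distrib)
qed

lemma eval_mpoly_zero [simp]: "eval_mpoly a 0 = 0"
  by (simp add: eval_mpoly_def)

lemma eval_mpoly_sum: "eval_mpoly a (sum h S) = (\<Sum>i\<in>S. eval_mpoly a (h i))"
  by (induction S rule: infinite_finite_induct) (auto simp: eval_mpoly_add)

lemma eval_mpoly_single:
  "eval_mpoly a (Poly_Mapping.single m c)
    = c * (\<Prod>v\<in>Poly_Mapping.keys m. a v ^ Poly_Mapping.lookup m v)"
  by (simp add: eval_mpoly_def)

lemma eval_mpoly_const [simp]: "eval_mpoly a (Poly_Mapping.single 0 c) = c"
  by (simp add: eval_mpoly_single)

lemma eval_mpoly_one [simp]: "eval_mpoly a 1 = 1"
  using eval_mpoly_const[of a 1] by simp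

lemma eval_mpoly_indet [simp]: "eval_mpoly a (indet v) = a v"
  by (simp add: indet_def eval_mpoly_single)

lemma eval_mpoly_mult: "eval_mpoly a (p * q) = eval_mpoly a p * eval_mpoly a q"
proof -
  have mon: "(\<Prod>v\<in>Poly_Mapping.keys (m + n). a v ^ Poly_Mapping.lookup (m + n) v)
    = (\<Prod>v\<in>Poly_Mapping.keys m. a v ^ Poly_Mapping.lookup m v) *
      (\<Prod>v\<in>Poly_Mapping.keys n. a v ^ Poly_Mapping.lookup n v)" for m n
  proof -
    let ?S = "Poly_Mapping.keys m \<union> Poly_Mapping.keys n"
    have *: "(\<Prod>v\<in>Poly_Mapping.keys k. a v ^ Poly_Mapping.lookup k v)
        = (\<Prod>v\<in>?S. a v ^ Poly_Mapping.lookup k v)" if "Poly_Mapping.keys k \<subseteq> ?S" for k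
      by (rule prod.mono_neutral_left) (use that in \<open>auto simp: in_keys_iff\<close>)
    show ?thesis
      unfolding *[OF Poly_Mapping.keys_add[of m n]] *[of m, OF Un_upper1] *[of n, OF Un_upper2]
      by (simp add: lookup_add power_add prod.distrib)
  qed
  have single: "eval_mpoly a (Poly_Mapping.single m c * Poly_Mapping.single n d)
      = eval_mpoly a (Poly_Mapping.single m c) * eval_mpoly a (Poly_Mapping.single n d)" for m n c d
    by (simp add: mult_single eval_mpoly_single mon ac_simps)
  show ?thesis
    by (subst (1 2) poly_mapping_eq_sum_single[of p], subst (1 2) poly_mapping_eq_sum_single[of q])
       (simp add: sum_product eval_mpoly_sum single)
qed

lemma eval_mpoly_uminus: "eval_mpoly a (- p) = - eval_mpoly a p"
  using eval_mpoly_add[of a p "- p"] by (simp add: add_eq_0_iff)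

lemma comm_ring_hom_eval_mpoly: "comm_ring_hom (eval_mpoly a)"
  by standard (auto simp: eval_mpoly_add eval_mpoly_mult)

text \<open>
  On a polynomial curve every polynomial restricts to a univariate one. This lets the irreducibility
  of a set of points be reduced to the absence of zero divisors among univariate polynomials.
\<close>
lemma eval_mpoly_curve:
  fixes q :: "'v \<Rightarrow> 'a::comm_ring_1 poly"
  shows "\<exists>Q. \<forall>s. eval_mpoly (\<lambda>v. poly (q v) s) p = poly Q s"
  by (intro exI[of _ "\<Sum>m\<in>Poly_Mapping.keys p. [:Poly_Mapping.lookup p m:] *
        (\<Prod>v\<in>Poly_Mapping.keys m. q v ^ Poly_Mapping.lookup m v)"])
     (simp add: eval_mpoly_def poly_sum poly_prod)

definition vanishing_ideal :: "'v set \<Rightarrow> ('v \<Rightarrow> 'a::comm_ring_1) set \<Rightarrow> ('v, 'a) mpoly set" where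
  "vanishing_ideal V Z = {p \<in> carrier (mpoly_ring V). \<forall>z\<in>Z. eval_mpoly z p = 0}"

lemma a_inv_mpoly_ring:
  assumes "p \<in> carrier (mpoly_ring V)"
  shows "\<ominus>\<^bsub>mpoly_ring V\<^esub> p = - p"
proof -
  interpret cring "mpoly_ring V :: ('a, 'b) mpoly ring" by (rule cring_mpoly_ring)
  have "- p \<in> carrier (mpoly_ring V)" using assms by (simp add: carrier_mpoly_ring)
  then show ?thesis using assms by (intro minus_equality) auto
qed

lemma ideal_vanishing_ideal: "ideal (vanishing_ideal V Z) (mpoly_ring V)"
proof -
  interpret cring "mpoly_ring V :: ('a, 'b) mpoly ring" by (rule cring_mpoly_ring)
  show ?thesis
  proof (rule idealI)
    show "ring (mpoly_ring V :: ('a, 'b) mpoly ring)" by (rule ring_axioms)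
    show "subgroup (vanishing_ideal V Z) (add_monoid (mpoly_ring V))"
    proof (rule add.subgroupI)
      show "vanishing_ideal V Z \<noteq> {}"
        using zero_closed by (auto simp: vanishing_ideal_def intro!: exI[of _ 0])
    qed (use a_closed a_inv_closed in \<open>auto simp: vanishing_ideal_def eval_mpoly_add eval_mpoly_uminus
           a_inv_mpoly_ring\<close>)
  qed (use m_closed in \<open>auto simp: vanishing_ideal_def eval_mpoly_mult\<close>)
qed

text \<open>
  If \<open>f\<close> does not vanish at \<open>a\<close> and \<open>g\<close> not at \<open>b\<close>, both restrict to nonzero univariate
  polynomials on a curve through \<open>a\<close> and \<open>b\<close> inside \<open>Z\<close>, and so does their product.
\<close>
lemma primeideal_vanishing_ideal:
  fixes Z :: "('v \<Rightarrow> 'a::field_char_0) set"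
  assumes "Z \<noteq> {}"
    and curve: "\<And>a b. a \<in> Z \<Longrightarrow> b \<in> Z \<Longrightarrow> \<exists>q. (\<lambda>v. poly (q v) 0) = a \<and> (\<lambda>v. poly (q v) 1) = b \<and>
          (\<forall>s. (\<lambda>v. poly (q v) s) \<in> Z)"
  shows "primeideal (vanishing_ideal V Z) (mpoly_ring V)"
proof (rule primeidealI)
  interpret cring "mpoly_ring V :: ('v, 'a) mpoly ring" by (rule cring_mpoly_ring)
  show "carrier (mpoly_ring V) \<noteq> vanishing_ideal V Z"
  proof -
    have "(1 :: ('v, 'a) mpoly) \<in> carrier (mpoly_ring V)" "1 \<notin> vanishing_ideal V Z"
      using one_closed assms(1) by (auto simp: vanishing_ideal_def)
    then show ?thesis by blast
  qed
  fix f g :: "('v, 'a) mpoly"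
  assume fg: "f \<in> carrier (mpoly_ring V)" "g \<in> carrier (mpoly_ring V)"
    "f \<otimes>\<^bsub>mpoly_ring V\<^esub> g \<in> vanishing_ideal V Z"
  show "f \<in> vanishing_ideal V Z \<or> g \<in> vanishing_ideal V Z"
  proof (rule ccontr)
    assume "\<not> ?thesis"
    then obtain a b where ab: "a \<in> Z" "eval_mpoly a f \<noteq> 0" "b \<in> Z" "eval_mpoly b g \<noteq> 0"
      using fg by (auto simp: vanishing_ideal_def)
    from curve[OF ab(1,3)] obtain q where q: "(\<lambda>v. poly (q v) 0) = a" "(\<lambda>v. poly (q v) 1) = b"
      "\<And>s. (\<lambda>v. poly (q v) s) \<in> Z" by blast
    obtain F G where F: "\<And>s. eval_mpoly (\<lambda>v. poly (q v) s) f = poly F s"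
      and G: "\<And>s. eval_mpoly (\<lambda>v. poly (q v) s) g = poly G s"
      using eval_mpoly_curve[of q f] eval_mpoly_curve[of q g] by auto
    have "poly F 0 \<noteq> 0" "poly G 1 \<noteq> 0" using ab q F[of 0] G[of 1] by auto
    then have "F * G \<noteq> 0" by auto
    moreover have "poly (F * G) s = 0" for s
      using fg(3) q(3)[of s] by (auto simp: vanishing_ideal_def eval_mpoly_mult simp flip: F G)
    ultimately show False using poly_all_0_iff_0 by blast
  qed
qed (rule ideal_vanishing_ideal cring_mpoly_ring)+

lemma subalgebra_mpoly_ring:
  "subalgebra (carrier (mpoly_ring V)) (Poly_Mapping.single 0 :: 'a::field \<Rightarrow> ('v, 'a) mpoly)"
proof -
  interpret R: cring "mpoly_ring V :: ('v, 'a) mpoly ring" by (rule cring_mpoly_ring)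
  show ?thesis
    by standard
       (use R.a_closed R.m_closed in \<open>auto simp: const_in_carrier single_add mult_single\<close>)
qed

lemma prime_of_subalgebra_mpoly_ring:
  fixes P :: "('v, 'a::field) mpoly set"
  assumes "primeideal P (mpoly_ring V)"
  shows "prime_of_subalgebra (carrier (mpoly_ring V)) P (Poly_Mapping.single 0)"
proof -
  interpret P: primeideal P "mpoly_ring V" by fact
  have sub: "additive_subgroup P (mpoly_ring V)" by (rule ideal.axioms(1)[OF P.ideal_axioms])
  note closed = additive_subgroup.a_closed[OF sub] P.I_l_closed
    additive_subgroup.zero_closed[OF sub]
  interpret subalgebra "carrier (mpoly_ring V)"
    "Poly_Mapping.single 0 :: 'a \<Rightarrow> ('v, 'a) mpoly" by (rule subalgebra_mpoly_ring)
  show ?thesis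
  proof
    show "1 \<notin> P" using P.one_imp_carrier P.I_notcarr by auto
  qed (use closed P.I_prime P.Icarr in auto)
qed

section \<open>Parametrizing a matrix modulo a prime ideal\<close>

lemma det_repeated_index:
  assumes "\<not> inj_on f {..<r} \<or> \<not> inj_on g {..<r}"
  shows "det (mat r r (\<lambda>(a, b). Y (f a) (g b))) = (0 :: 'a::comm_ring_1)"
  using assms
proof
  assume "\<not> inj_on f {..<r}"
  then obtain a b where "a < r" "b < r" "a \<noteq> b" "f a = f b" by (auto simp: inj_on_def)
  then show ?thesis
    by (intro det_identical_rows[of _ r a b]) auto
next
  assume "\<not> inj_on g {..<r}"
  then obtain a b where "a < r" "b < r" "a \<noteq> b" "g a = g b" by (auto simp: inj_on_def)
  then show ?thesis
    by (intro det_identical_columns[of _ r a b]) auto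
qed

text \<open>
  Bordering a minor by the row \<open>i\<close> and the column \<open>l\<close> and expanding along the new column gives
  coefficients that are independent of \<open>l\<close>. They are minors themselves, up to sign, so that
  they lie in every subalgebra containing the entries.
\<close>
lemma det_bordered:
  fixes U :: "'r \<Rightarrow> 'c \<Rightarrow> 'a::comm_ring_1"
  shows "\<exists>c. (\<forall>l. det (mat (Suc s) (Suc s) (\<lambda>(a, b). U ((f(s := i)) a) ((g(s := l)) b)))
            = (\<Sum>a<s. c a * U (f a) l) + det (mat s s (\<lambda>(a, b). U (f a) (g b))) * U i l)
       \<and> (\<forall>a. \<exists>\<epsilon>\<in>{1, -1}. \<exists>h. h ` {..<s} \<subseteq> insert i (f ` {..<s}) \<and>
             c a = \<epsilon> * det (mat s s (\<lambda>(a, b). U (h a) (g b))))"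
proof -
  define F where "F = f(s := i)"
  define h where "h a p = F (if p < a then p else Suc p)" for a p
  define c where "c a = (-1) ^ (a + s) * det (mat s s (\<lambda>(p, q). U (h a p) (g q)))" for a
  have "det (mat (Suc s) (Suc s) (\<lambda>(a, b). U (F a) ((g(s := l)) b)))
      = (\<Sum>a<s. c a * U (f a) l) + det (mat s s (\<lambda>(a, b). U (f a) (g b))) * U i l" for l
  proof -
    define M where "M = mat (Suc s) (Suc s) (\<lambda>(a, b). U (F a) ((g(s := l)) b))"
    have "mat_delete M a s = mat s s (\<lambda>(p, q). U (h a p) (g q))" if "a < Suc s" for a
      unfolding mat_delete_def using that by (intro eq_matI) (auto simp: M_def h_def)
    then have cof: "cofactor M a s = c a" if "a < Suc s" for a
      using that by (simp add: cofactor_def c_def)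
    have "mat s s (\<lambda>(p, q). U (h s p) (g q)) = mat s s (\<lambda>(a, b). U (f a) (g b))"
      by (intro eq_matI) (auto simp: h_def F_def)
    then have cs: "c s = det (mat s s (\<lambda>(a, b). U (f a) (g b)))"
      by (simp add: c_def)
    have "det M = (\<Sum>a<Suc s. M $$ (a, s) * cofactor M a s)"
      by (rule laplace_expansion_column) (auto simp: M_def)
    also have "\<dots> = (\<Sum>a<Suc s. U (F a) l * c a)"
    proof (intro sum.cong refl)
      fix a assume "a \<in> {..<Suc s}"
      then have "a < Suc s" "M $$ (a, s) = U (F a) l" by (simp_all add: M_def)
      then show "M $$ (a, s) * cofactor M a s = U (F a) l * c a" by (simp add: cof)
    qed
    also have "\<dots> = (\<Sum>a<s. c a * U (f a) l) + c s * U i l"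
      by (simp add: F_def mult.commute)
    finally show ?thesis by (simp add: M_def cs)
  qed
  moreover have "\<exists>\<epsilon>\<in>{1, -1}. \<exists>h. h ` {..<s} \<subseteq> insert i (f ` {..<s}) \<and>
             c a = \<epsilon> * det (mat s s (\<lambda>(a, b). U (h a) (g b)))" for a
  proof -
    have "(-1 :: 'a) ^ (a + s) \<in> {1, -1}" by (cases "even (a + s)") auto
    moreover have "h a ` {..<s} \<subseteq> insert i (f ` {..<s})"
      by (auto simp: h_def F_def)
    ultimately show ?thesis unfolding c_def by blast
  qed
  ultimately show ?thesis unfolding F_def by blast
qed

context prime_of_subalgebra
begin

text \<open>
  Rank over a domain, without its field of fractions: for a nonvanishing minor \<open>\<Delta>\<close> of maximal size,
  all bordered minors vanish, and their expansions express \<open>\<Delta>\<close> times an arbitrary row by the rows of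
  \<open>\<Delta>\<close>.
\<close>
lemma rows_span_of_vanishing_minors:
  assumes U: "\<And>i l. i \<in> R \<Longrightarrow> l \<in> C \<Longrightarrow> U i l \<in> A"
    and minors: "\<And>f g. f ` {..<Suc r} \<subseteq> R \<Longrightarrow> g ` {..<Suc r} \<subseteq> C \<Longrightarrow>
        det (mat (Suc r) (Suc r) (\<lambda>(a, b). U (f a) (g b))) \<in> P"
    and R: "finite R" "r \<le> card R"
  obtains \<Delta> R' c where "\<Delta> \<in> A" "\<Delta> \<notin> P" "R' \<subseteq> R" "card R' = r"
    "\<And>i \<rho>. i \<in> R \<Longrightarrow> c i \<rho> \<in> A"
    "\<And>i l. i \<in> R \<Longrightarrow> l \<in> C \<Longrightarrow> \<Delta> * U i l - (\<Sum>\<rho>\<in>R'. c i \<rho> * U \<rho> l) \<in> P"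
proof -
  let ?D = "\<lambda>s f g. det (mat s s (\<lambda>(a, b). U (f a) (g b)))"
  define good where "good s \<longleftrightarrow> s \<le> r \<and>
      (\<exists>f g. f ` {..<s} \<subseteq> R \<and> g ` {..<s} \<subseteq> C \<and> ?D s f g \<notin> P)" for s
  have "good 0" by (auto simp: good_def P_one)
  then obtain s where s: "good s" and max: "\<And>s'. good s' \<Longrightarrow> s' \<le> s"
    using Nat.ex_has_greatest_nat[of good 0 r] by (auto simp: good_def)
  from s obtain f g where sr: "s \<le> r" and f: "f ` {..<s} \<subseteq> R" and g: "g ` {..<s} \<subseteq> C"
    and nz: "?D s f g \<notin> P" by (auto simp: good_def)
  define \<Delta> where "\<Delta> = ?D s f g"
  have DA: "?D s h g \<in> A" if "h ` {..<s} \<subseteq> R" for h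
    using that g by (intro det_A U) auto
  have larger: "?D (Suc s) h k \<in> P" if "h ` {..<Suc s} \<subseteq> R" "k ` {..<Suc s} \<subseteq> C" for h k
  proof (cases "s = r")
    case True
    then show ?thesis using minors that by blast
  next
    case False
    then have "\<not> good (Suc s)" using max[of "Suc s"] by auto
    then show ?thesis using False sr that by (auto simp: good_def)
  qed
  have "\<exists>c. (\<forall>a. c a \<in> A) \<and> (\<forall>l\<in>C. (\<Sum>a<s. c a * U (f a) l) + \<Delta> * U i l \<in> P)"
    if i: "i \<in> R" for i
  proof -
    from det_bordered[of s U f i g] obtain c where
      c: "\<And>l. ?D (Suc s) (f(s := i)) (g(s := l)) = (\<Sum>a<s. c a * U (f a) l) + \<Delta> * U i l"
      and cA: "\<And>a. \<exists>\<epsilon>\<in>{1, -1}. \<exists>h. h ` {..<s} \<subseteq> insert i (f ` {..<s}) \<and> c a = \<epsilon> * ?D s h g"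
      unfolding \<Delta>_def by blast
    have "c a \<in> A" for a
    proof -
      obtain \<epsilon> h where "\<epsilon> \<in> {1, -1}" "h ` {..<s} \<subseteq> insert i (f ` {..<s})" "c a = \<epsilon> * ?D s h g"
        using cA by blast
      moreover from this have "?D s h g \<in> A" using f i by (intro DA) auto
      ultimately show ?thesis by (auto simp: A_minus)
    qed
    moreover have "(\<Sum>a<s. c a * U (f a) l) + \<Delta> * U i l \<in> P" if "l \<in> C" for l
      unfolding c[symmetric] using f g i that by (intro larger) (auto simp: less_Suc_eq)
    ultimately show ?thesis by blast
  qed
  then obtain c where c: "\<And>i a. i \<in> R \<Longrightarrow> c i a \<in> A"
    "\<And>i l. i \<in> R \<Longrightarrow> l \<in> C \<Longrightarrow> (\<Sum>a<s. c i a * U (f a) l) + \<Delta> * U i l \<in> P" by metis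
  have inj: "inj_on f {..<s}"
    using nz det_repeated_index[of f s g U] P_zero by metis
  obtain R' where R': "f ` {..<s} \<subseteq> R'" "R' \<subseteq> R" "card R' = r"
    using exists_subset_between[of "f ` {..<s}" r R] f R sr inj by (auto simp: card_image)
  \<comment> \<open>Rows of \<open>R'\<close> outside the minor only pad \<open>R'\<close> to \<open>r\<close> elements when the rank is smaller.\<close>
  define c' where "c' i \<rho> = (if \<rho> \<in> f ` {..<s} then - c i (inv_into {..<s} f \<rho>) else 0)" for i \<rho>
  have "(\<Sum>\<rho>\<in>R'. c' i \<rho> * U \<rho> l) = - (\<Sum>a<s. c i a * U (f a) l)" for i l
  proof -
    have "(\<Sum>\<rho>\<in>R'. c' i \<rho> * U \<rho> l) = (\<Sum>\<rho>\<in>f ` {..<s}. c' i \<rho> * U \<rho> l)"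
      by (rule sum.mono_neutral_right)
         (use R' R finite_subset in \<open>auto simp: c'_def\<close>)
    also have "\<dots> = (\<Sum>a<s. - (c i a * U (f a) l))"
      using inj by (subst sum.reindex) (auto simp: c'_def intro!: sum.cong)
    finally show ?thesis by (simp add: sum_negf)
  qed
  then have "\<Delta> * U i l - (\<Sum>\<rho>\<in>R'. c' i \<rho> * U \<rho> l) \<in> P" if "i \<in> R" "l \<in> C" for i l
    using c(2)[OF that] by (simp add: add.commute)
  moreover have "c' i \<rho> \<in> A" if "i \<in> R" for i \<rho>
    using c(1)[OF that] by (auto simp: c'_def A_zero A_minus)
  ultimately show ?thesis
    using that[of \<Delta> R' c'] R' nz DA[OF f] by (auto simp: \<Delta>_def)
qed

lemma forms_cong: "x - y \<in> P \<Longrightarrow> y \<in> forms Y w M \<Longrightarrow> x \<in> forms Y w M"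
  using forms_add[OF forms_P, of "x - y" y Y w M] by simp

text \<open>
  Modulo \<open>P\<close>, each nonzero block \<open>l\<close> has a nonzero entry \<open>p l\<close> in some row \<open>i0 l\<close> and column \<open>j0 l\<close>.
  The 2-minors give \<open>x i j l = x i (j0 l) l * (x (i0 l) j l / p l)\<close>, where the second factor is a
  parameter unless \<open>j = j0 l\<close>. The columns \<open>j0 l\<close> form a matrix \<open>U\<close> of rank at most \<open>r\<close>; its entries
  in \<open>r\<close> rows \<open>R'\<close> are parameters, and so are the coefficients \<open>c i \<rho> / \<Delta>\<close> that express the other rows.
  Hence an entry is a polynomial of degree at most 3 in the parameters. The common
  denominator \<open>w\<close> is the product of \<open>\<Delta>\<close> and all \<open>p l\<close>, and \<open>Y1\<close>, \<open>Y2\<close>, \<open>Y3\<close> are the numerators.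
\<close>
lemma exists_parameters:
  fixes x :: "nat \<Rightarrow> nat \<Rightarrow> nat \<Rightarrow> 'a" and d k1 k2 r :: nat
  defines "V \<equiv> {1..d} \<times> {1..k1} \<times> {1..k2}"
  assumes x: "\<And>i j l. (i, j, l) \<in> V \<Longrightarrow> x i j l \<in> A"
    and two_minors: "\<And>i i' j j' l. (i, j, l) \<in> V \<Longrightarrow> (i', j', l) \<in> V \<Longrightarrow>
        x i j l * x i' j' l - x i j' l * x i' j l \<in> P"
    and minors: "\<And>f g. f ` {..<Suc r} \<subseteq> {1..d} \<Longrightarrow> g ` {..<Suc r} \<subseteq> {1..k1} \<times> {1..k2} \<Longrightarrow>
        det (mat (Suc r) (Suc r) (\<lambda>(a, b). x (f a) (fst (g b)) (snd (g b)))) \<in> P"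
    and r: "r \<le> d" and k1: "1 \<le> k1"
  obtains Y w where "finite Y" "Y \<subseteq> A" "card Y \<le> (d - r) * r + r * k2 + k2 * (k1 - 1)"
    "w \<in> A" "w \<notin> P" "\<And>i j l. (i, j, l) \<in> V \<Longrightarrow> w ^ 3 * x i j l \<in> forms Y w 3"
proof -
  let ?L = "{1..k2}" and ?R = "{1..d}" and ?J = "{1..k1}"
  define nz where "nz l \<longleftrightarrow> (\<exists>i\<in>?R. \<exists>j\<in>?J. x i j l \<notin> P)" for l
  have "\<exists>i0 j0. j0 \<in> ?J \<and> (nz l \<longrightarrow> i0 \<in> ?R \<and> x i0 j0 l \<notin> P)" for l
  proof (cases "nz l")
    case True
    then show ?thesis unfolding nz_def by blast
  next
    case False
    then show ?thesis using k1 by (intro exI[of _ 1]) simp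
  qed
  then obtain i0 j0 where j0: "\<And>l. j0 l \<in> ?J"
    and i0: "\<And>l. nz l \<Longrightarrow> i0 l \<in> ?R" "\<And>l. nz l \<Longrightarrow> x (i0 l) (j0 l) l \<notin> P"
    by metis
  \<comment> \<open>The value \<open>1\<close> for a block that vanishes modulo \<open>P\<close> keeps the common denominator outside \<open>P\<close>.\<close>
  define p where "p l = (if nz l then x (i0 l) (j0 l) l else 1)" for l
  have p: "p l \<in> A - P" if "l \<in> ?L" for l
    using i0[of l] j0[of l] that x P_one A_one by (auto simp: p_def V_def)
  define U where "U i l = x i (j0 l) l" for i l
  have UA: "U i l \<in> A" if "i \<in> ?R" "l \<in> ?L" for i l
    using that j0[of l] x by (auto simp: U_def V_def)
  have Uminors: "det (mat (Suc r) (Suc r) (\<lambda>(a, b). U (f a) (g b))) \<in> P"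
    if "f ` {..<Suc r} \<subseteq> ?R" "g ` {..<Suc r} \<subseteq> ?L" for f g
    using minors[of f "\<lambda>b. (j0 (g b), g b)"] that j0 by (force simp: U_def)
  obtain \<Delta> R' c where \<Delta>: "\<Delta> \<in> A" "\<Delta> \<notin> P" and R': "R' \<subseteq> ?R" "card R' = r"
    and c: "\<And>i \<rho>. i \<in> ?R \<Longrightarrow> c i \<rho> \<in> A"
      "\<And>i l. i \<in> ?R \<Longrightarrow> l \<in> ?L \<Longrightarrow> \<Delta> * U i l - (\<Sum>\<rho>\<in>R'. c i \<rho> * U \<rho> l) \<in> P"
    by (rule rows_span_of_vanishing_minors[of ?R ?L U r, OF UA Uminors]) (use r in auto)
  define q where "q = prod p ?L"
  define q' where "q' l = prod p (?L - {l})" for l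
  have q: "q \<in> A" "q \<notin> P" and q'A: "q' l \<in> A" for l
    using p notin_P_prod[of ?L p] by (auto simp: q_def q'_def intro!: A_prod)
  have qq': "q = p l * q' l" if "l \<in> ?L" for l
    unfolding q_def q'_def using that by (intro prod.remove) auto
  define w where "w = \<Delta> * q"
  have w: "w \<in> A" "w \<notin> P" using \<Delta> q P_prime by (auto simp: w_def A_mult)
  define v where "v j l = (if nz l then \<Delta> * q' l * x (i0 l) j l else 0)" for j l
  define Y1 where "Y1 = (\<lambda>(i, \<rho>). q * c i \<rho>) ` ((?R - R') \<times> R')"
  define Y2 where "Y2 = (\<lambda>(\<rho>, l). w * U \<rho> l) ` (R' \<times> ?L)"
  define Y3 where "Y3 = (\<lambda>(l, j). v j l) ` (SIGMA l:?L. ?J - {j0 l})"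
  define Y where "Y = Y1 \<union> Y2 \<union> Y3"
  have finR': "finite R'" using R' finite_subset by blast
  have Y_fin: "finite Y" using finR' by (simp add: Y_def Y1_def Y2_def Y3_def)
  have vA: "v j l \<in> A" if "j \<in> ?J" "l \<in> ?L" for j l
    using that i0[of l] x \<Delta> q'A by (auto simp: v_def V_def A_zero intro!: A_mult)
  have Y_A: "Y \<subseteq> A"
    using R' c(1) q w UA vA by (auto simp: Y_def Y1_def Y2_def Y3_def intro!: A_mult)
  have Y_card: "card Y \<le> (d - r) * r + r * k2 + k2 * (k1 - 1)"
  proof -
    have "card Y1 \<le> card ((?R - R') \<times> R')" "card Y2 \<le> card (R' \<times> ?L)"
      "card Y3 \<le> card (SIGMA l:?L. ?J - {j0 l})"
      unfolding Y1_def Y2_def Y3_def by (rule card_image_le; use finR' in simp)+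
    moreover have "card (SIGMA l:?L. ?J - {j0 l}) = k2 * (k1 - 1)"
      using j0 by simp
    moreover have "card (?R - R') = d - r"
      using R' finR' by (simp add: card_Diff_subset)
    moreover have "card Y \<le> card Y1 + card Y2 + card Y3"
      unfolding Y_def by (meson add_right_mono card_Un_le order_trans)
    ultimately show ?thesis using R' by (simp add: card_cartesian_product)
  qed
  have w_form: "w \<in> forms Y w 1"
    by (rule monomial_in_forms[OF denominator_in_hom_monomials])
  have Y_form: "y \<in> forms Y w 1" if "y \<in> Y" for y
    by (rule monomial_in_forms[OF parameter_in_hom_monomials[OF Y_fin that]])
  have two: "1 + 1 = (2::nat)" by simp
  have mult11: "y * z \<in> forms Y w 2" if "y \<in> forms Y w 1" "z \<in> forms Y w 1" for y z
    using forms_mult[OF that Y_A w(1)] unfolding two .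
  have U_form: "w\<^sup>2 * U i l \<in> forms Y w 2" if il: "i \<in> ?R" "l \<in> ?L" for i l
  proof (cases "i \<in> R'")
    case True
    then have "w * U i l \<in> Y" using il by (auto simp: Y_def Y2_def)
    then have "w * (w * U i l) \<in> forms Y w 2" by (intro mult11 w_form Y_form)
    then show ?thesis by (simp add: power2_eq_square mult.assoc)
  next
    case False
    have combination: "(\<Sum>\<rho>\<in>R'. (q * c i \<rho>) * (w * U \<rho> l)) \<in> forms Y w 2"
      using False il by (intro forms_sum mult11 Y_form) (auto simp: Y_def Y1_def Y2_def)
    have difference: "w\<^sup>2 * U i l - (\<Sum>\<rho>\<in>R'. (q * c i \<rho>) * (w * U \<rho> l))
        = (w * q) * (\<Delta> * U i l - (\<Sum>\<rho>\<in>R'. c i \<rho> * U \<rho> l))"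
    proof -
      have "w\<^sup>2 * U i l = (w * q) * (\<Delta> * U i l)"
        by (simp add: w_def power2_eq_square)
      moreover have "(\<Sum>\<rho>\<in>R'. (q * c i \<rho>) * (w * U \<rho> l)) = (w * q) * (\<Sum>\<rho>\<in>R'. c i \<rho> * U \<rho> l)"
        unfolding sum_distrib_left by (rule sum.cong) (simp_all only: mult_ac)
      ultimately show ?thesis by (simp only: right_diff_distrib)
    qed
    show ?thesis
    proof (rule forms_cong[OF _ combination])
      show "w\<^sup>2 * U i l - (\<Sum>\<rho>\<in>R'. (q * c i \<rho>) * (w * U \<rho> l)) \<in> P"
        unfolding difference by (rule P_mult[OF A_mult[OF w(1) q(1)] c(2)[OF il]])
    qed
  qed
  have "w ^ 3 * x i j l \<in> forms Y w 3" if "(i, j, l) \<in> V" for i j l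
  proof (cases "nz l")
    case False
    then have "x i j l \<in> P" using that by (auto simp: nz_def V_def)
    then show ?thesis by (intro forms_P P_mult A_power w)
  next
    case True
    have ijl: "i \<in> ?R" "j \<in> ?J" "l \<in> ?L" using that by (auto simp: V_def)
    have v_form: "v j l \<in> forms Y w 1"
    proof (cases "j = j0 l")
      case True
      then have "v j l = w"
        using \<open>nz l\<close> qq'[OF ijl(3)] by (simp add: v_def w_def p_def mult_ac)
      then show ?thesis using w_form by simp
    next
      case False
      then show ?thesis using ijl by (intro Y_form) (auto simp: Y_def Y3_def)
    qed
    have product: "w\<^sup>2 * U i l * v j l \<in> forms Y w 3"
      using forms_mult[OF U_form[OF ijl(1,3)] v_form Y_A w(1)] by simp
    have difference: "w ^ 3 * x i j l - w\<^sup>2 * U i l * v j l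
       = w\<^sup>2 * \<Delta> * q' l * (x i j l * x (i0 l) (j0 l) l - x i (j0 l) l * x (i0 l) j l)"
    proof -
      have "w ^ 3 = w\<^sup>2 * \<Delta> * q' l * x (i0 l) (j0 l) l"
        using qq'[OF ijl(3)] True by (simp add: power3_eq_cube power2_eq_square w_def p_def mult_ac)
      then show ?thesis using True by (simp add: v_def U_def algebra_simps)
    qed
    have "w ^ 3 * x i j l - w\<^sup>2 * U i l * v j l \<in> P"
      unfolding difference
    proof (rule P_mult)
      show "w\<^sup>2 * \<Delta> * q' l \<in> A" by (intro A_mult A_power w(1) \<Delta>(1) q'A)
      show "x i j l * x (i0 l) (j0 l) l - x i (j0 l) l * x (i0 l) j l \<in> P"
        by (rule two_minors) (use i0(1)[OF True] j0[of l] ijl in \<open>simp_all add: V_def\<close>)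
    qed
    then show ?thesis by (rule forms_cong[OF _ product])
  qed
  then show ?thesis using that Y_fin Y_A Y_card w by blast
qed

end

section \<open>The length of chains of primes above the ideal is bounded\<close>

lemma subalgebra_CX:
  "subalgebra (carrier (CX d k1 k2)) (Poly_Mapping.single 0)"
  unfolding CX_def by (rule subalgebra_mpoly_ring)

lemma cring_CX: "cring (CX d k1 k2)"
  unfolding CX_def by (rule cring_mpoly_ring)

lemma minors_subset_carrier:
  assumes "C \<subseteq> {1..k1} \<times> {1..k2}"
  shows "minors r X_mat {1..d} C \<subseteq> carrier (CX d k1 k2)"
proof -
  have "X_mat i c \<in> carrier (CX d k1 k2)" if "i \<in> {1..d}" "c \<in> C" for i c
    using that assms unfolding X_mat_def CX_def by (intro indet_in_carrier) auto
  then have "det (mat r r (\<lambda>(a, b). X_mat (f a) (g b))) \<in> carrier (CX d k1 k2)"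
    if "f ` {..<r} \<subseteq> {1..d}" "g ` {..<r} \<subseteq> C" for f g
    using that by (intro subalgebra.det_A[OF subalgebra_CX]) blast
  then show ?thesis unfolding minors_def by blast
qed

lemma C_cols_subset: "l \<in> {1..k2} \<Longrightarrow> C_cols k1 l \<subseteq> {1..k1} \<times> {1..k2}"
  by (auto simp: C_cols_def)

lemma I_empty_generators:
  "minors t X_mat {1..d} ({1..k1} \<times> {1..k2}) \<subseteq> I_empty d k1 k2 t"
  "l \<in> {1..k2} \<Longrightarrow> minors 2 X_mat {1..d} (C_cols k1 l) \<subseteq> I_empty d k1 k2 t"
  and ideal_I_empty: "ideal (I_empty d k1 k2 t) (CX d k1 k2)"
  and I_empty_subset: "\<lbrakk>ideal J (CX d k1 k2); minors t X_mat {1..d} ({1..k1} \<times> {1..k2}) \<subseteq> J;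
      \<And>l. l \<in> {1..k2} \<Longrightarrow> minors 2 X_mat {1..d} (C_cols k1 l) \<subseteq> J\<rbrakk> \<Longrightarrow> I_empty d k1 k2 t \<subseteq> J"
proof -
  interpret cring "CX d k1 k2" by (rule cring_CX)
  let ?G = "minor_ideal d k1 k2 t ({1..k1} \<times> {1..k2}) \<union>
      (\<Union>i\<in>{1..k2}. minor_ideal d k1 k2 2 (C_cols k1 i))"
  have carr: "minor_ideal d k1 k2 r C \<subseteq> carrier (CX d k1 k2)"
    if "C \<subseteq> {1..k1} \<times> {1..k2}" for r C
    unfolding minor_ideal_def
    by (rule ideal.Icarr[OF genideal_ideal[OF minors_subset_carrier[OF that]], THEN subsetI])
  have self: "minors r X_mat {1..d} C \<subseteq> minor_ideal d k1 k2 r C"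
    if "C \<subseteq> {1..k1} \<times> {1..k2}" for r C
    unfolding minor_ideal_def by (rule genideal_self[OF minors_subset_carrier[OF that]])
  have G: "?G \<subseteq> carrier (CX d k1 k2)" using carr[OF order.refl] carr[OF C_cols_subset] by blast
  have GI: "?G \<subseteq> I_empty d k1 k2 t"
    unfolding I_empty_def by (rule genideal_self[OF G])
  show "minors t X_mat {1..d} ({1..k1} \<times> {1..k2}) \<subseteq> I_empty d k1 k2 t"
    using GI self[of "{1..k1} \<times> {1..k2}" t] by blast
  show "minors 2 X_mat {1..d} (C_cols k1 l) \<subseteq> I_empty d k1 k2 t" if "l \<in> {1..k2}"
    using GI self[OF C_cols_subset[OF that], of 2] that by blast
  show "ideal (I_empty d k1 k2 t) (CX d k1 k2)"
    unfolding I_empty_def by (rule genideal_ideal[OF G])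
  show "I_empty d k1 k2 t \<subseteq> J"
    if "ideal J (CX d k1 k2)" "minors t X_mat {1..d} ({1..k1} \<times> {1..k2}) \<subseteq> J"
      "\<And>l. l \<in> {1..k2} \<Longrightarrow> minors 2 X_mat {1..d} (C_cols k1 l) \<subseteq> J"
    unfolding I_empty_def
  proof (rule genideal_minimal[OF that(1)])
    show "?G \<subseteq> J"
      unfolding minor_ideal_def by (intro Un_least UN_least genideal_minimal that)
  qed
qed

lemma det_mat_2: "det (mat 2 2 h) = h (0, 0) * h (1, 1) - h (0, 1) * (h (1, 0) :: 'a::comm_ring_1)"
proof -
  have 1: "det (mat (Suc 0) (Suc 0) e) = e (0, 0)" for e :: "nat \<times> nat \<Rightarrow> 'a"
    by (subst det_single) auto
  have "det (mat 2 2 h) = (\<Sum>i<2. mat 2 2 h $$ (i, 0) * cofactor (mat 2 2 h) i 0)"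
    by (rule laplace_expansion_column) auto
  then show ?thesis
    by (simp add: numeral_2_eq_2 cofactor_def mat_delete_def 1)
qed

text \<open>
  The polynomials that are fractions over \<open>w\<close> in the parameters form a subring containing the
  constants and the indeterminates, so all polynomials are of this form, in particular those
  that witness the strictness of the chain.
\<close>
lemma chain_length_le:
  assumes chain: "\<And>i. i \<le> m \<Longrightarrow> primeideal (Q i) (CX d k1 k2)"
      "\<And>i. i \<le> m \<Longrightarrow> I_empty d k1 k2 (Suc r) \<subseteq> Q i" "\<And>i. i < m \<Longrightarrow> Q i \<subset> Q (Suc i)"
    and r: "r \<le> d" and k1: "1 \<le> k1"
  shows "m \<le> (d - r) * r + r * k2 + k2 * (k1 - 1)"
proof -
  let ?A = "carrier (CX d k1 k2)" and ?\<kappa> = "Poly_Mapping.single 0 :: complex \<Rightarrow> _"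
  let ?V = "{1..d} \<times> {1..k1} \<times> {1..k2}"
  have prime: "prime_of_subalgebra ?A (Q i) ?\<kappa>" if "i \<le> m" for i
    using chain(1)[OF that] unfolding CX_def by (rule prime_of_subalgebra_mpoly_ring)
  interpret prime_of_subalgebra ?A "Q 0" ?\<kappa> using prime by simp
  have I: "I_empty d k1 k2 (Suc r) \<subseteq> Q 0" using chain(2) by simp
  define x where "x i j l = X_mat i (j, l)" for i j l
  have "\<exists>Y w. finite Y \<and> Y \<subseteq> ?A \<and> card Y \<le> (d - r) * r + r * k2 + k2 * (k1 - 1) \<and>
    w \<in> ?A \<and> w \<notin> Q 0 \<and> (\<forall>i j l. (i, j, l) \<in> ?V \<longrightarrow> w ^ 3 * x i j l \<in> forms Y w 3)"
  proof (rule exists_parameters[of d k1 k2 x r])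
    show "x i j l \<in> ?A" if "(i, j, l) \<in> ?V" for i j l
      using that unfolding x_def X_mat_def CX_def by (rule indet_in_carrier)
    show "x i j l * x i' j' l - x i j' l * x i' j l \<in> Q 0"
      if "(i, j, l) \<in> ?V" "(i', j', l) \<in> ?V" for i i' j j' l
    proof (cases "i = i' \<or> j = j'")
      case True
      then show ?thesis by (auto simp: P_zero mult.commute)
    next
      case False
      let ?f = "\<lambda>a::nat. if a = 0 then i else i'" and ?g = "\<lambda>b::nat. if b = 0 then (j, l) else (j', l)"
      have two: "{..<2} = {0, Suc 0}" by auto
      have "inj_on ?f {..<2}" "inj_on ?g {..<2}"
        using False by (simp_all add: two)
      moreover have "?f ` {..<2} \<subseteq> {1..d}" "?g ` {..<2} \<subseteq> C_cols k1 l"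
        using that by (simp_all add: two C_cols_def)
      ultimately have "det (mat 2 2 (\<lambda>(a, b). X_mat (?f a) (?g b))) \<in> minors 2 X_mat {1..d} (C_cols k1 l)"
        unfolding minors_def by (intro CollectI exI[of _ ?f] exI[of _ ?g] conjI refl)
      then have "det (mat 2 2 (\<lambda>(a, b). X_mat (?f a) (?g b))) \<in> Q 0"
        using I I_empty_generators(2)[of l k2 d k1 "Suc r"] that(1) by auto
      then show ?thesis by (simp add: det_mat_2 x_def)
    qed
    show "det (mat (Suc r) (Suc r) (\<lambda>(a, b). x (f a) (fst (g b)) (snd (g b)))) \<in> Q 0"
      if fg: "f ` {..<Suc r} \<subseteq> {1..d}" "g ` {..<Suc r} \<subseteq> {1..k1} \<times> {1..k2}" for f g
    proof (cases "inj_on f {..<Suc r} \<and> inj_on g {..<Suc r}")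
      case True
      then have "det (mat (Suc r) (Suc r) (\<lambda>(a, b). X_mat (f a) (g b)))
          \<in> minors (Suc r) X_mat {1..d} ({1..k1} \<times> {1..k2})"
        unfolding minors_def using fg by blast
      then have "det (mat (Suc r) (Suc r) (\<lambda>(a, b). X_mat (f a) (g b))) \<in> Q 0"
        by (intro subsetD[OF I] subsetD[OF I_empty_generators(1)])
      then show ?thesis by (simp add: x_def)
    next
      case False
      then show ?thesis
        using det_repeated_index[of f "Suc r" g X_mat] P_zero by (auto simp: x_def)
    qed
  qed (use r k1 in auto)
  then obtain Y w where Y: "finite Y" "Y \<subseteq> ?A" "card Y \<le> (d - r) * r + r * k2 + k2 * (k1 - 1)"
    and w: "w \<in> ?A" "w \<notin> Q 0"
    and coord: "\<And>i j l. (i, j, l) \<in> ?V \<Longrightarrow> w ^ 3 * x i j l \<in> forms Y w 3"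
    by blast
  have fractions: "\<exists>M. w ^ M * p \<in> forms Y w M" if "p \<in> ?A" for p
    using that unfolding CX_def
  proof (induction rule: mpoly_ring_induct)
    case (const c)
    show ?case
      using forms_monomial[OF one_in_hom_monomials, of c Y w] by (intro exI[of _ 0]) simp
  next
    case (indet v)
    then show ?case
      using coord by (cases v) (auto simp: x_def X_mat_def)
  next
    case (add p q)
    then obtain M N where MN: "w ^ M * p \<in> forms Y w M" "w ^ N * q \<in> forms Y w N" by blast
    have "w ^ max M N * p + w ^ max M N * q \<in> forms Y w (max M N)"
      by (intro forms_add fraction_raise[OF MN(1) Y(2) w(1)] fraction_raise[OF MN(2) Y(2) w(1)])
         auto
    then show ?case by (auto simp: distrib_left)
  next
    case (mult p q)
    then show ?case using fraction_mult[OF _ _ Y(2) w(1)] by blast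
  qed
  have "\<exists>f. f \<in> Q (Suc i) - Q i" if "i < m" for i
    using chain(3)[OF that] by blast
  then obtain f where f: "\<And>i. i < m \<Longrightarrow> f i \<in> Q (Suc i) - Q i" by metis
  define fs where "fs = map f [0..<m]"
  have fs: "length fs = m" "\<And>i. i < m \<Longrightarrow> fs ! i = f i" by (simp_all add: fs_def)
  have fsA: "set fs \<subseteq> ?A"
  proof
    fix p assume "p \<in> set fs"
    then obtain i where i: "i < m" "p = f i" by (auto simp: fs_def)
    then show "p \<in> ?A"
      using f[OF i(1)] prime_of_subalgebra.P_A[OF prime[of "Suc i"]] by auto
  qed
  have "length fs \<le> card Y"
  proof (rule independent_family_le_parameters[OF Y(1,2) w fsA])
    fix N c
    assume "(\<Sum>es\<in>bounded_exponents (length fs) N. ?\<kappa> (c es) * power_product fs es) \<in> Q 0"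
    then show "\<forall>es\<in>bounded_exponents (length fs) N. c es = 0"
      by (rule chain_of_primes_independent[rotated 3]) (use prime chain(3) f fs in auto)
  qed (use fractions fsA in auto)
  then show ?thesis using Y(3) fs(1) by simp
qed

section \<open>A chain of primes that attains the bound\<close>

text \<open>
  \<open>Row s l\<close> is the entry of \<open>u\<^sub>l\<close> in one of the first \<open>r\<close> rows, \<open>Coef i s\<close> the coefficient of
  row \<open>s\<close> in a later row \<open>i\<close>, and \<open>Scale j l\<close> the factor by which the column \<open>j\<close> of block \<open>l\<close> differs
  from its first column \<open>u\<^sub>l\<close>.
\<close>
datatype param = Row nat nat | Coef nat nat | Scale nat nat

definition base_vector :: "nat \<Rightarrow> (param \<Rightarrow> 'a::comm_ring_1) \<Rightarrow> nat \<Rightarrow> nat \<Rightarrow> 'a" where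
  "base_vector r y i l
    = (if i \<le> r then y (Row i l) else (\<Sum>s=1..r. y (Coef i s) * y (Row s l)))"

text \<open>
  The ring of the parameters is left open: applied to univariate polynomials, the same formula
  describes a curve of points.
\<close>
definition point :: "nat \<Rightarrow> (param \<Rightarrow> 'a::comm_ring_1) \<Rightarrow> nat \<times> nat \<times> nat \<Rightarrow> 'a" where
  "point r y = (\<lambda>(i, j, l). base_vector r y i l * (if j = 1 then 1 else y (Scale j l)))"

definition params :: "nat \<Rightarrow> nat \<Rightarrow> nat \<Rightarrow> nat \<Rightarrow> param set" where
  "params d k1 k2 r = case_prod Row ` ({1..r} \<times> {1..k2}) \<union>
     case_prod Coef ` ({r<..d} \<times> {1..r}) \<union> case_prod Scale ` ({1<..k1} \<times> {1..k2})"

text \<open>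
  The order in which the parameters are set to zero. It is chosen so that at its turn
  each parameter is a matrix entry up to a factor that is still free. The \<open>Scale\<close> parameters go
  first, while the first row of the \<open>u\<^sub>l\<close> is free. The \<open>Row\<close> parameters are matrix entries at any
  time, but \<open>Row s s\<close> is kept to the end: once the others are zero, \<open>u\<^sub>s\<close> has the entry
  \<open>Coef i s * Row s s\<close> in a later row \<open>i\<close>.
\<close>
fun stage :: "param \<Rightarrow> nat" where
  "stage (Scale j l) = 0"
| "stage (Row s l) = (if s = l then 3 else 1)"
| "stage (Coef i s) = 2"

lemma finite_params: "finite (params d k1 k2 r)"
  by (simp add: params_def)

lemma card_params: "card (params d k1 k2 r) = (d - r) * r + r * k2 + k2 * (k1 - 1)"
proof -
  have "inj (case_prod Row)" "inj (case_prod Coef)" "inj (case_prod Scale)"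
    by (auto simp: inj_def)
  then have inj: "inj_on (case_prod Row) S" "inj_on (case_prod Coef) S" "inj_on (case_prod Scale) S"
    for S by (auto intro: inj_on_subset)
  show ?thesis
    unfolding params_def
    by (subst card_Un_disjoint, simp, simp, fastforce)+ (simp add: card_image inj)
qed

definition stratum :: "nat \<Rightarrow> param set \<Rightarrow> (nat \<times> nat \<times> nat \<Rightarrow> 'a::comm_ring_1) set" where
  "stratum r K = point r ` {y. \<forall>\<tau>\<in>K. y \<tau> = 0}"

text \<open>
  The parameters run through a linear space, so any two points are joined by the image of
  a line.
\<close>
lemma primeideal_stratum:
  "primeideal (vanishing_ideal V (stratum r K :: (_ \<Rightarrow> 'a::field_char_0) set)) (mpoly_ring V)"
proof (rule primeideal_vanishing_ideal)
  show "stratum r K \<noteq> ({} :: (_ \<Rightarrow> 'a) set)"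
    unfolding stratum_def by (auto intro!: exI[of _ "\<lambda>_. 0"])
  fix a b :: "nat \<times> nat \<times> nat \<Rightarrow> 'a"
  assume "a \<in> stratum r K" "b \<in> stratum r K"
  then obtain y z where yz: "a = point r y" "\<forall>\<tau>\<in>K. y \<tau> = 0" "b = point r z" "\<forall>\<tau>\<in>K. z \<tau> = 0"
    by (auto simp: stratum_def)
  define q where "q = point r (\<lambda>\<tau>. [:y \<tau>, z \<tau> - y \<tau>:])"
  have q: "(\<lambda>v. poly (q v) s) = point r (\<lambda>\<tau>. y \<tau> + s * (z \<tau> - y \<tau>))" for s
    by (auto simp: q_def point_def base_vector_def poly_sum fun_eq_iff
          simp del: mult_pCons_left mult_pCons_right)
  show "\<exists>q. (\<lambda>v. poly (q v) 0) = a \<and> (\<lambda>v. poly (q v) 1) = b \<and>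
      (\<forall>s. (\<lambda>v. poly (q v) s) \<in> stratum r K)"
    by (rule exI[of _ q]) (use yz in \<open>auto simp: q stratum_def\<close>)
qed

text \<open>
  The matrix factors through square matrices, of which the second has a zero row.
\<close>
lemma det_low_rank:
  fixes \<alpha> :: "nat \<Rightarrow> nat \<Rightarrow> 'a::comm_ring_1"
  assumes "r < n"
  shows "det (mat n n (\<lambda>(a, b). \<Sum>s<r. \<alpha> a s * \<beta> s b)) = 0"
proof -
  define M where "M = mat n n (\<lambda>(a, s). if s < r then \<alpha> a s else 0)"
  define N where "N = mat n n (\<lambda>(s, b). if s < r then \<beta> s b else 0)"
  have "mat n n (\<lambda>(a, b). \<Sum>s<r. \<alpha> a s * \<beta> s b) = M * N"
  proof (intro eq_matI)
    fix a b assume "a < dim_row (M * N)" "b < dim_col (M * N)"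
    then have ab: "a < n" "b < n" by (simp_all add: M_def N_def)
    have "(M * N) $$ (a, b) = (\<Sum>s<n. if s < r then \<alpha> a s * \<beta> s b else 0)"
      using ab by (auto simp: M_def N_def scalar_prod_def atLeast0LessThan intro!: sum.cong)
    also have "\<dots> = (\<Sum>s<r. \<alpha> a s * \<beta> s b)"
      using assms by (intro sum.mono_neutral_cong_right) auto
    finally show "mat n n (\<lambda>(a, b). \<Sum>s<r. \<alpha> a s * \<beta> s b) $$ (a, b) = (M * N) $$ (a, b)"
      using ab by simp
  qed (auto simp: M_def N_def)
  moreover have "det (M * N) = det M * det N"
    by (rule det_mult[of _ n]) (auto simp: M_def N_def)
  moreover have "det N = (\<Sum>b<n. N $$ (r, b) * cofactor N r b)"
    by (rule laplace_expansion_row) (use assms in \<open>auto simp: N_def\<close>)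
  moreover have "\<dots> = 0"
    using assms by (intro sum.neutral) (auto simp: N_def)
  ultimately show ?thesis by simp
qed

lemma minors_vanish_of_factorization:
  assumes "r < n"
    and z: "\<And>i c. i \<in> R \<Longrightarrow> c \<in> C \<Longrightarrow> z (i, c) = (\<Sum>s<r. \<alpha> i s * \<beta> s c)"
    and p: "p \<in> minors n X_mat R C"
  shows "eval_mpoly z p = 0"
proof -
  interpret comm_ring_hom "eval_mpoly z" by (rule comm_ring_hom_eval_mpoly)
  from p obtain f g where p: "p = det (mat n n (\<lambda>(a, b). X_mat (f a) (g b)))"
    and fg: "f ` {..<n} \<subseteq> R" "g ` {..<n} \<subseteq> C" by (auto simp: minors_def)
  have "map_mat (eval_mpoly z) (mat n n (\<lambda>(a, b). X_mat (f a) (g b)))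
      = mat n n (\<lambda>(a, b). \<Sum>s<r. \<alpha> (f a) s * \<beta> s (g b))"
    using fg z by (intro eq_matI) (auto simp: X_mat_def image_subset_iff)
  then show ?thesis
    unfolding p hom_det[symmetric] by (simp add: det_low_rank[OF assms(1)])
qed

lemma I_empty_vanishes_on_stratum:
  assumes "r < t" and "2 \<le> t"
  shows "I_empty d k1 k2 t
    \<subseteq> vanishing_ideal ({1..d} \<times> {1..k1} \<times> {1..k2}) (stratum r K)"
proof (rule I_empty_subset)
  let ?V = "{1..d} \<times> {1..k1} \<times> {1..k2}"
  show "ideal (vanishing_ideal ?V (stratum r K)) (CX d k1 k2)"
    unfolding CX_def by (rule ideal_vanishing_ideal)
  have "eval_mpoly (point r y) p = 0" if "p \<in> minors t X_mat {1..d} ({1..k1} \<times> {1..k2})" for y p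
  proof (rule minors_vanish_of_factorization[OF assms(1) _ that])
    define \<alpha> where "\<alpha> i s = (if i \<le> r then (if i = Suc s then 1 else 0) else y (Coef i (Suc s)))"
      for i s
    define \<beta> where "\<beta> s c = y (Row (Suc s) (snd c)) * (if fst c = 1 then 1 else y (Scale (fst c) (snd c)))"
      for s and c :: "nat \<times> nat"
    fix i c assume i: "i \<in> {1..d}" and "c \<in> {1..k1} \<times> {1..k2}"
    have "base_vector r y i l = (\<Sum>s<r. \<alpha> i s * y (Row (Suc s) l))" for l
    proof (cases "i \<le> r")
      case True
      have "(\<Sum>s<r. \<alpha> i s * y (Row (Suc s) l)) = (\<Sum>s<r. if s = i - 1 then y (Row i l) else 0)"
        using i True by (intro sum.cong) (auto simp: \<alpha>_def)
      also have "\<dots> = y (Row i l)"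
      proof -
        have "i - 1 < r" using i True by auto
        then show ?thesis by simp
      qed
      finally show ?thesis using True by (simp add: base_vector_def)
    next
      case False
      then show ?thesis
        by (simp add: base_vector_def \<alpha>_def sum.atLeast1_atMost_eq)
    qed
    then show "point r y (i, c) = (\<Sum>s<r. \<alpha> i s * \<beta> s c)"
      by (cases c) (simp add: point_def \<beta>_def sum_distrib_right mult.assoc)
  qed
  then show "minors t X_mat {1..d} ({1..k1} \<times> {1..k2}) \<subseteq> vanishing_ideal ?V (stratum r K)"
    using minors_subset_carrier[of "{1..k1} \<times> {1..k2}" k1 k2 t d]
    by (auto simp: vanishing_ideal_def stratum_def CX_def)
  fix l assume l: "l \<in> {1..k2}"
  have "eval_mpoly (point r y) p = 0" if "p \<in> minors 2 X_mat {1..d} (C_cols k1 l)" for y p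
    by (rule minors_vanish_of_factorization[OF _ _ that, of 1 _ "\<lambda>i s. base_vector r y i l"
          "\<lambda>s c. if fst c = 1 then 1 else y (Scale (fst c) l)"])
       (auto simp: point_def C_cols_def)
  then show "minors 2 X_mat {1..d} (C_cols k1 l) \<subseteq> vanishing_ideal ?V (stratum r K)"
    using minors_subset_carrier[OF C_cols_subset[OF l], of 2 d k1]
    by (auto simp: vanishing_ideal_def stratum_def CX_def)
qed

text \<open>
  Here \<open>K\<close> is the set of the parameters that are already zero when \<open>\<tau>\<close> is about to become zero, and
  \<open>v\<close> is the matrix entry that changes from not identically zero to zero. Setting all
  parameters outside \<open>K\<close> to \<open>1\<close> shows the former.
\<close>
lemma stage_witness:
  fixes K :: "param set"
  assumes r: "1 \<le> r" "r \<le> d" "r \<le> k2" "1 \<le> k1"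
    and \<tau>: "\<tau> \<in> params d k1 k2 r" "\<tau> \<notin> K"
    and before: "\<And>\<sigma>. \<sigma> \<in> params d k1 k2 r \<Longrightarrow> stage \<sigma> < stage \<tau> \<Longrightarrow> \<sigma> \<in> K"
    and not_after: "\<And>\<sigma>. \<sigma> \<in> K \<Longrightarrow> stage \<sigma> \<le> stage \<tau>"
  obtains v where "v \<in> {1..d} \<times> {1..k1} \<times> {1..k2}"
    "\<And>y :: param \<Rightarrow> 'a::idom. \<forall>\<sigma>\<in>insert \<tau> K. y \<sigma> = 0 \<Longrightarrow> point r y v = 0"
    "\<exists>y :: param \<Rightarrow> 'a. (\<forall>\<sigma>\<in>K. y \<sigma> = 0) \<and> point r y v \<noteq> 0"
proof -
  define y0 :: "param \<Rightarrow> 'a" where "y0 \<sigma> = (if \<sigma> \<in> K then 0 else 1)" for \<sigma>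
  have y0: "\<forall>\<sigma>\<in>K. y0 \<sigma> = 0" "y0 \<tau> = 1"
    using \<tau> by (auto simp: y0_def)
  show ?thesis
  proof (cases \<tau>)
    case (Scale j l)
    then have jl: "j \<noteq> 1" "(1, j, l) \<in> {1..d} \<times> {1..k1} \<times> {1..k2}"
      using \<tau> r by (auto simp: params_def)
    have "Row 1 l \<notin> K" using not_after[of "Row 1 l"] Scale by (auto split: if_splits)
    then have "y0 (Row 1 l) = 1" by (simp add: y0_def)
    then show ?thesis
      using jl y0 r Scale by (intro that[of "(1, j, l)"]) (auto simp: point_def base_vector_def)
  next
    case (Row s l)
    then have "s \<le> r" "(s, 1, l) \<in> {1..d} \<times> {1..k1} \<times> {1..k2}"
      using \<tau> r by (auto simp: params_def)
    then show ?thesis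
      using y0 Row by (intro that[of "(s, 1, l)"]) (auto simp: point_def base_vector_def)
  next
    case (Coef i s)
    then have iv: "\<not> i \<le> r" "s \<in> {1..r}" "(i, 1, s) \<in> {1..d} \<times> {1..k1} \<times> {1..k2}"
      using \<tau> r by (auto simp: params_def)
    have K: "Row \<sigma> s \<in> K" if "\<sigma> \<in> {1..r}" "\<sigma> \<noteq> s" for \<sigma>
      by (rule before) (use that iv Coef in \<open>auto simp: params_def\<close>)
    have "Row s s \<notin> K" using not_after[of "Row s s"] Coef by auto
    then have y0s: "y0 (Row s s) = 1" by (simp add: y0_def)
    have pt: "point r y (i, 1, s) = y (Coef i s) * y (Row s s)" if "\<forall>\<sigma>\<in>K. y \<sigma> = 0"
      for y :: "param \<Rightarrow> 'a"
    proof -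
      have "(\<Sum>\<sigma>=1..r. y (Coef i \<sigma>) * y (Row \<sigma> s)) = (\<Sum>\<sigma>\<in>{s}. y (Coef i \<sigma>) * y (Row \<sigma> s))"
      proof (rule sum.mono_neutral_right)
        show "\<forall>\<sigma>\<in>{1..r} - {s}. y (Coef i \<sigma>) * y (Row \<sigma> s) = 0"
          using K that by simp
      qed (use iv in auto)
      then show ?thesis using iv by (simp add: point_def base_vector_def)
    qed
    show ?thesis
    proof (rule that[OF iv(3)])
      show "point r y (i, 1, s) = 0" if "\<forall>\<sigma>\<in>insert \<tau> K. y \<sigma> = 0" for y :: "param \<Rightarrow> 'a"
        using pt[of y] that Coef by simp
      show "\<exists>y :: param \<Rightarrow> 'a. (\<forall>\<sigma>\<in>K. y \<sigma> = 0) \<and> point r y (i, 1, s) \<noteq> 0"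
        using pt[OF y0(1)] y0 y0s Coef by (intro exI[of _ y0]) simp
    qed
  qed
qed

lemma exists_prime_chain:
  assumes r: "1 \<le> r" "r \<le> d" "r \<le> k2" "1 \<le> k1"
  defines "D \<equiv> (d - r) * r + r * k2 + k2 * (k1 - 1)"
  obtains P where "\<And>i. primeideal (P i) (CX d k1 k2)" "\<And>i. I_empty d k1 k2 (Suc r) \<subseteq> P i"
    "\<And>i. i < D \<Longrightarrow> P i \<subset> P (Suc i)"
proof -
  let ?T = "params d k1 k2 r" and ?V = "{1..d} \<times> {1..k1} \<times> {1..k2}"
  obtain L0 where L0: "set L0 = ?T" "distinct L0"
    using finite_distinct_list[OF finite_params] by blast
  define L where "L = sort_key stage L0"
  have L: "set L = ?T" "distinct L" "sorted (map stage L)"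
    using L0 by (simp_all add: L_def)
  have len: "length L = D"
    using distinct_card[OF L(2)] L(1) card_params by (simp add: D_def)
  define K where "K i = set (take i L)" for i
  define P where "P i = vanishing_ideal ?V (stratum r (K i) :: (_ \<Rightarrow> complex) set)" for i
  have "P i \<subset> P (Suc i)" if i: "i < D" for i
  proof -
    define \<tau> where "\<tau> = L ! i"
    have iL: "i < length L" using i len by simp
    have KS: "K (Suc i) = insert \<tau> (K i)"
      using iL by (simp add: K_def \<tau>_def take_Suc_conv_app_nth)
    have "distinct (take i L @ [\<tau>])"
      using distinct_take[OF L(2), of "Suc i"] iL by (simp add: \<tau>_def take_Suc_conv_app_nth)
    then have \<tau>: "\<tau> \<in> ?T" "\<tau> \<notin> K i"
      using nth_mem[OF iL] L(1) by (simp_all add: \<tau>_def K_def)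
    have before: "\<sigma> \<in> K i" if \<sigma>: "\<sigma> \<in> ?T" "stage \<sigma> < stage \<tau>" for \<sigma>
    proof -
      from \<sigma>(1) obtain j where j: "j < length L" "\<sigma> = L ! j"
        unfolding L(1)[symmetric] by (auto simp: in_set_conv_nth)
      have "\<not> i \<le> j"
        using sorted_nth_mono[OF L(3), of i j] j \<sigma>(2) iL by (auto simp: \<tau>_def)
      then show ?thesis using j by (auto simp: K_def in_set_conv_nth intro!: exI[of _ j])
    qed
    have not_after: "stage \<sigma> \<le> stage \<tau>" if "\<sigma> \<in> K i" for \<sigma>
    proof -
      from that obtain j where "j < i" "\<sigma> = L ! j"
        using iL by (auto simp: K_def in_set_conv_nth)
      then show ?thesis
        using sorted_nth_mono[OF L(3), of j i] iL by (auto simp: \<tau>_def)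
    qed
    obtain v where v: "v \<in> ?V"
      "\<And>y :: param \<Rightarrow> complex. \<forall>\<sigma>\<in>insert \<tau> (K i). y \<sigma> = 0 \<Longrightarrow> point r y v = 0"
      "\<exists>y :: param \<Rightarrow> complex. (\<forall>\<sigma>\<in>K i. y \<sigma> = 0) \<and> point r y v \<noteq> 0"
      by (rule stage_witness[OF r \<tau> before not_after]) auto
    have "indet v \<in> P (Suc i)" "indet v \<notin> P i"
      using v indet_in_carrier[OF v(1)] by (auto simp: P_def vanishing_ideal_def stratum_def KS)
    moreover have "P i \<subseteq> P (Suc i)"
      by (auto simp: P_def vanishing_ideal_def stratum_def KS)
    ultimately show ?thesis by blast
  qed
  moreover have "primeideal (P i) (CX d k1 k2)" for i
    unfolding P_def CX_def by (rule primeideal_stratum)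
  moreover have "I_empty d k1 k2 (Suc r) \<subseteq> P i" for i
    unfolding P_def by (rule I_empty_vanishes_on_stratum) (use r in auto)
  ultimately show ?thesis using that by blast
qed

theorem theorem5p1:
  fixes k1 k2 d t :: nat
  assumes "2 \<le> k1" and "2 \<le> t" and "t \<le> min k2 d"
  shows "ideal_dim (CX d k1 k2) (I_empty d k1 k2 t)
           = enat ((t - 1) * (d + k2) + k2 * (k1 - 1) - (t - 1)^2)
         \<and> (t - 1) * (d + k2) + k2 * (k1 - 1) - (t - 1)^2
           = (t - 1) * (d + k2 - t + 1) + k2 * (k1 - 1)"
proof -
  define r where "r = t - 1"
  have t: "t = Suc r" and r: "1 \<le> r" "r \<le> d" "r \<le> k2" "1 \<le> k1"
    using assms by (auto simp: r_def)
  define D where "D = (d - r) * r + r * k2 + k2 * (k1 - 1)"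
  obtain e where e: "d = r + e" using r(2) le_Suc_ex by blast
  have D1: "(t - 1) * (d + k2) + k2 * (k1 - 1) - (t - 1)^2 = D"
    by (simp add: t e D_def algebra_simps power2_eq_square)
  have D2: "(t - 1) * (d + k2 - t + 1) + k2 * (k1 - 1) = D"
  proof -
    have "d + k2 - t + 1 = e + k2" using assms r by (simp add: t e)
    then show ?thesis by (simp add: t e D_def algebra_simps)
  qed
  obtain P where P: "\<And>i. primeideal (P i) (CX d k1 k2)" "\<And>i. I_empty d k1 k2 t \<subseteq> P i"
    "\<And>i. i < D \<Longrightarrow> P i \<subset> P (Suc i)"
    using exists_prime_chain[OF r] unfolding t D_def by metis
  have "krull_dim (CX d k1 k2 Quot I_empty d k1 k2 t) = enat D"
  proof (rule krull_dim_Quot_eqI[where P = P and n = D])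
    fix m Q
    assume "\<And>i. i \<le> m \<Longrightarrow> primeideal (Q i) (CX d k1 k2)" "\<And>i. i \<le> m \<Longrightarrow> I_empty d k1 k2 t \<subseteq> Q i"
      "\<And>i. i < m \<Longrightarrow> Q i \<subset> Q (Suc i)"
    then show "m \<le> D"
      unfolding t D_def by (rule chain_length_le) (use r in auto)
  qed (use cring_CX ideal_I_empty P in auto)
  then show ?thesis unfolding ideal_dim_def D1 D2 by simp
qed

end
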